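(* There is an uncountable, almost disjoint family $\mathcal{A}\subseteq[\mathbb{N}]^\omega$ such that every bounded linear operator $T\colon C_0(K_{\mathcal{A}})\to C_0(K_{\mathcal{A}})$ has the form $T=\lambda\,\mathrm{Id}+S$ for some scalar $\lambda\in\mathbb{K}$ and some operator $S\colon C_0(K_{\mathcal{A}})\to C_0(K_{\mathcal{A}})$ that factors through $c_0$.
   Context: $\mathbb{N}=\{0,1,2,\ldots\}$; $[\mathbb{N}]^\omega$ and $[\mathbb{N}]^{<\omega}$ denote the families of all infinite, respectively finite, subsets of $\mathbb{N}$. A family $\mathcal{A}\subseteq[\mathbb{N}]^\omega$ is almost disjoint if $A\cap A'$ is finite whenever $A,A'\in\mathcal{A}$ are distinct. The scalar field $\mathbb{K}$ is $\mathbb{R}$ or $\mathbb{C}$ (the results hold for both). For an almost disjoint family $\mathcal{A}$, $K_{\mathcal{A}}$ is the (locally compact, scattered, Hausdorff) topological space consisting of distinct points $\{x_n:n\in\mathbb{N}\}\cup\{y_A:A\in\mathcal{A}\}$, where each $x_n$ is isolated and, for each $A\in\mathcal{A}$, the sets $U(A,F)=\{x_n:n\in A\setminus F\}\cup\{y_A\}$ for $F\in[\mathbb{N}]^{<\omega}$ form a neighbourhood basis at $y_A$. For a locally compact Hausdorff space $K$, $C_0(K)$ is the Banach space of all continuous $f\colon K\to\mathbb{K}$ such that $\{x\in K:|f(x)|\ge\varepsilon\}$ is compact for each $\varepsilon>0$, with the supremum norm. An operator $S$ on a Banach space $\mathcal{X}$ factors through $c_0$ if $S=VU$ for some bounded linear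 operators $U\colon\mathcal{X}\to c_0$ and $V\colon c_0\to\mathcal{X}$. *)

theory Defs
  imports "HOL-Analysis.Analysis"
begin

definition almost_disjoint :: "'a set set \<Rightarrow> bool" where
  "almost_disjoint \<A> \<longleftrightarrow> pairwise (\<lambda>A B. finite (A \<inter> B)) \<A>"

text \<open>
  The space \<open>K\<^sub>\<A>\<close>: the isolated point \<open>x\<^sub>n\<close> is encoded as \<open>Inl n\<close> and the point \<open>y\<^sub>A\<close>
  as \<open>Inr A\<close>.
\<close>

definition psi_nbhd :: "nat set \<Rightarrow> nat set \<Rightarrow> (nat + nat set) set" where
  "psi_nbhd A F = insert (Inr A) (Inl ` (A - F))"

definition psi_open :: "nat set set \<Rightarrow> (nat + nat set) set \<Rightarrow> bool" where
  "psi_open \<A> U \<longleftrightarrow> U \<subseteq> range Inl \<union> Inr ` \<A> \<and>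
     (\<forall>A. Inr A \<in> U \<longrightarrow> (\<exists>F. finite F \<and> psi_nbhd A F \<subseteq> U))"

definition psi_space :: "nat set set \<Rightarrow> (nat + nat set) topology" where
  "psi_space \<A> = topology (psi_open \<A>)"

lemma istopology_psi_open: "istopology (psi_open \<A>)"
  unfolding istopology_def
proof (intro conjI allI impI)
  fix S T assume S: "psi_open \<A> S" and T: "psi_open \<A> T"
  show "psi_open \<A> (S \<inter> T)"
    unfolding psi_open_def
  proof (intro conjI allI impI)
    show "S \<inter> T \<subseteq> range Inl \<union> Inr ` \<A>"
      using S unfolding psi_open_def by blast
    fix A assume "Inr A \<in> S \<inter> T"
    then obtain F G where "finite F" "psi_nbhd A F \<subseteq> S" "finite G" "psi_nbhd A G \<subseteq> T"
      using S T unfolding psi_open_def by blast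
    then have "finite (F \<union> G) \<and> psi_nbhd A (F \<union> G) \<subseteq> S \<inter> T"
      by (auto simp: psi_nbhd_def)
    then show "\<exists>H. finite H \<and> psi_nbhd A H \<subseteq> S \<inter> T" ..
  qed
next
  fix \<U> assume U: "\<forall>U\<in>\<U>. psi_open \<A> U"
  show "psi_open \<A> (\<Union>\<U>)"
    unfolding psi_open_def
  proof (intro conjI allI impI)
    show "\<Union>\<U> \<subseteq> range Inl \<union> Inr ` \<A>"
      using U unfolding psi_open_def by blast
    fix A assume "Inr A \<in> \<Union>\<U>"
    then obtain V where V: "V \<in> \<U>" "Inr A \<in> V" by blast
    then obtain F where "finite F" "psi_nbhd A F \<subseteq> V"
      using U unfolding psi_open_def by blast
    then show "\<exists>F. finite F \<and> psi_nbhd A F \<subseteq> \<Union>\<U>"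
      using V(1) by blast
  qed
qed

lemma openin_psi_space: "openin (psi_space \<A>) U \<longleftrightarrow> psi_open \<A> U"
  by (simp add: psi_space_def topology_inverse'[OF istopology_psi_open])

lemma openin_psi_space_isolated: "openin (psi_space \<A>) {Inl n}"
  by (auto simp: openin_psi_space psi_open_def)

lemma openin_psi_nbhd: "A \<in> \<A> \<Longrightarrow> finite F \<Longrightarrow> openin (psi_space \<A>) (psi_nbhd A F)"
  by (auto simp: openin_psi_space psi_open_def psi_nbhd_def)

lemma topspace_psi_space: "topspace (psi_space \<A>) = range Inl \<union> Inr ` \<A>"
proof (rule antisym)
  have "psi_open \<A> (topspace (psi_space \<A>))"
    using openin_topspace openin_psi_space by blast
  then show "topspace (psi_space \<A>) \<subseteq> range Inl \<union> Inr ` \<A>"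
    unfolding psi_open_def by blast
  have "psi_open \<A> (range Inl \<union> Inr ` \<A>)"
    by (auto simp: psi_open_def psi_nbhd_def)
  then show "range Inl \<union> Inr ` \<A> \<subseteq> topspace (psi_space \<A>)"
    using openin_subset openin_psi_space by blast
qed

text \<open>
  Elements of \<open>C\<^sub>0(K)\<close> are represented by total functions that are \<open>0\<close> off the space.
  This makes the representation unique, so that equality of functions is equality in
  \<open>C\<^sub>0(K)\<close>, and the supremum over the whole type below is the supremum over \<open>K\<close>.
\<close>

definition C0_space :: "'a topology \<Rightarrow> ('a \<Rightarrow> 'k::real_normed_field) set" where
  "C0_space X = {f. continuous_map X euclidean f \<and>
     (\<forall>\<epsilon>>0. compactin X {x \<in> topspace X. norm (f x) \<ge> \<epsilon>}) \<and>
     (\<forall>x. x \<notin> topspace X \<longrightarrow> f x = 0)}"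

definition c0_space :: "(nat \<Rightarrow> 'k::real_normed_field) set" where
  "c0_space = {f. f \<longlonglongrightarrow> 0}"

text \<open>Only meaningful for bounded functions, which covers \<^const>\<open>C0_space\<close> and \<^const>\<open>c0_space\<close>.\<close>

definition sup_norm :: "('a \<Rightarrow> 'k::real_normed_field) \<Rightarrow> real" where
  "sup_norm f = (SUP x. norm (f x))"

text \<open>
  Bounded \<open>'k\<close>-linear operators between spaces of \<open>'k\<close>-valued functions with the supremum norm.
  The library predicate \<^const>\<open>bounded_linear\<close> is not applicable: it is only about real
  scalars and about operators defined on an entire type. Here the values of \<open>T\<close> outside \<open>E\<close>
  are irrelevant.
\<close>

definition bounded_operator ::
    "('a \<Rightarrow> 'k::real_normed_field) set \<Rightarrow> ('b \<Rightarrow> 'k) set \<Rightarrow> (('a \<Rightarrow> 'k) \<Rightarrow> ('b \<Rightarrow> 'k)) \<Rightarrow> bool" where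
  "bounded_operator E G T \<longleftrightarrow>
     (\<forall>f\<in>E. T f \<in> G) \<and>
     (\<forall>f\<in>E. \<forall>g\<in>E. T (\<lambda>x. f x + g x) = (\<lambda>y. T f y + T g y)) \<and>
     (\<forall>c. \<forall>f\<in>E. T (\<lambda>x. c * f x) = (\<lambda>y. c * T f y)) \<and>
     (\<exists>B. \<forall>f\<in>E. sup_norm (T f) \<le> B * sup_norm f)"

definition factors_through_c0 ::
    "('a \<Rightarrow> 'k::real_normed_field) set \<Rightarrow> (('a \<Rightarrow> 'k) \<Rightarrow> ('a \<Rightarrow> 'k)) \<Rightarrow> bool" where
  "factors_through_c0 E S \<longleftrightarrow>
     (\<exists>U V. bounded_operator E c0_space U \<and> bounded_operator c0_space E V \<and>
        (\<forall>f\<in>E. S f = V (U f)))"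

end

theory Submission
  imports Defs
begin

text \<open>
  An operator \<open>T\<close> on \<open>C\<^sub>0(K\<^sub>\<A>)\<close> has a matrix \<open>M n m = T \<delta>\<^sub>m (x\<^sub>n)\<close> with absolutely summable rows, and for all but
  countably many \<open>A \<in> \<A>\<close> the function \<open>T \<chi>\<^sub>A\<close> is given on the isolated points by the sums of the rows
  over \<open>A\<close>. There are only continuum many matrices. The members of \<open>\<A>\<close> are chosen as infinite subsets
  of unions of two branches of the binary tree, no branch being used twice. If \<open>M\<close> is not asymptotically
  scalar on the union of two branches, then the union has an infinite subset \<open>A\<close> along which \<open>M\<close>
  does not act convergently, and a matrix for which \<open>\<A>\<close> contains uncountably many such \<open>A\<close> does not
  come from an operator. For a given \<open>M\<close>, either countably many branches meet all the pairs on which \<open>M\<close> is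
  not asymptotically scalar, or a perfect set argument gives continuum many pairwise disjoint such
  pairs. A transfinite recursion then provides uncountably many obstacles \<open>A\<close> for
  every \<open>M\<close> of the second kind simultaneously. For the operators that remain, some \<open>T - \<lambda> Id\<close> takes
  values that vanish at all but countably many of the points \<open>y\<^sub>A\<close>, so it factors through \<open>c\<^sub>0\<close>.
\<close>

section \<open>Pairs of branches\<close>

text \<open>Two branches are joined because single branches cannot exclude multiplication by the
  indicator of the nodes that extend a fixed node: on a subset of one branch it acts as 0 or as 1 up
  to a finite set, while the union of a branch through the node and a branch avoiding it sees both
  values. Matrices are listed, not operators, since operators make sense only once
  \<open>\<A>\<close> is complete. As the matrix may fail to describe \<open>T (chi A)\<close> for
  countably many \<open>A\<close>, a single obstacle would prove nothing, and every matrix has to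
  return at uncountably many stages. The recursion has continuum many stages, and at each of them
  fewer than continuum many branches are taken; without the continuum hypothesis an arbitrary
  uncountable supply of disjoint pairs could run out, which is why the perfect set argument has to
  deliver continuum many.\<close>

definition branch :: "(nat \<Rightarrow> bool) \<Rightarrow> nat set" where
  "branch x = range (\<lambda>k. to_nat (map x [0..<k]))"

definition branches :: "(nat \<Rightarrow> bool) \<times> (nat \<Rightarrow> bool) \<Rightarrow> nat set" where
  "branches p = branch (fst p) \<union> branch (snd p)"

definition agree :: "nat \<Rightarrow> (nat \<Rightarrow> bool) \<Rightarrow> (nat \<Rightarrow> bool) \<Rightarrow> bool" where
  "agree n x y \<longleftrightarrow> map x [0..<n] = map y [0..<n]"

lemma agree_iff: "agree n x y \<longleftrightarrow> (\<forall>i<n. x i = y i)"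
  by (auto simp: agree_def)

lemma agree_mono: "agree n x y \<Longrightarrow> m \<le> n \<Longrightarrow> agree m x y"
  by (simp add: agree_iff)

lemma infinite_branch: "infinite (branch x)"
proof -
  have "inj (\<lambda>k. to_nat (map x [0..<k]))"
    by (rule injI) (metis diff_zero length_map length_upt to_nat_split)
  then show ?thesis
    unfolding branch_def by (rule range_inj_infinite)
qed

lemma finite_branch_Int:
  assumes "x \<noteq> y"
  shows "finite (branch x \<inter> branch y)"
proof -
  obtain i where i: "x i \<noteq> y i" using assms by blast
  have "branch x \<inter> branch y \<subseteq> (\<lambda>k. to_nat (map x [0..<k])) ` {..i}"
  proof
    fix n assume "n \<in> branch x \<inter> branch y"
    then obtain k l where k: "n = to_nat (map x [0..<k])" and l: "n = to_nat (map y [0..<l])"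
      unfolding branch_def by blast
    then have eq: "map x [0..<k] = map y [0..<l]" by simp
    then have "k = l" by (metis diff_zero length_map length_upt)
    with eq have "\<forall>j<k. x j = y j" by auto
    with i have "k \<le> i" by (meson not_le)
    with k show "n \<in> (\<lambda>k. to_nat (map x [0..<k])) ` {..i}" by blast
  qed
  then show ?thesis by (rule finite_subset) simp
qed

section \<open>Separated pairs, cylinders and open conditions on pairs\<close>

definition separated :: "'a \<times> 'a \<Rightarrow> 'a \<times> 'a \<Rightarrow> bool" where
  "separated p q \<longleftrightarrow> {fst p, snd p} \<inter> {fst q, snd q} = {}"

lemma finite_branches_Int: "separated p q \<Longrightarrow> finite (branches p \<inter> branches q)"
  by (auto simp: separated_def branches_def Int_Un_distrib Int_Un_distrib2 finite_branch_Int)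

text \<open>These are basic clopen sets of the square of the Cantor space;
  \<open>countable_range_cyl\<close> is its second countability.\<close>

definition cyl :: "nat \<Rightarrow> (nat \<Rightarrow> bool) \<times> (nat \<Rightarrow> bool) \<Rightarrow> ((nat \<Rightarrow> bool) \<times> (nat \<Rightarrow> bool)) set" where
  "cyl n p = {q. agree n (fst q) (fst p) \<and> agree n (snd q) (snd p)}"

lemma self_in_cyl: "p \<in> cyl n p"
  by (simp add: cyl_def agree_def)

lemma cyl_subset: "q \<in> cyl m p \<Longrightarrow> m \<le> n \<Longrightarrow> cyl n q \<subseteq> cyl m p"
  by (auto simp: cyl_def agree_iff)

lemma countable_range_cyl: "countable (range (\<lambda>(n, p). cyl n p))"
proof -
  define D where "D = (\<lambda>(n, u, v). {q :: (nat \<Rightarrow> bool) \<times> (nat \<Rightarrow> bool).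
    map (fst q) [0..<n] = u \<and> map (snd q) [0..<n] = v})"
  have "cyl n p = D (n, map (fst p) [0..<n], map (snd p) [0..<n])" for n p
    by (simp only: D_def cyl_def agree_def prod.case)
  then have "range (\<lambda>(n, p). cyl n p) \<subseteq> range D" by auto
  then show ?thesis by (rule countable_subset) simp
qed

lemma branch_agree: 
  assumes "n \<in> branch x"
  shows "\<exists>k. \<forall>y. agree k y x \<longrightarrow> n \<in> branch y"
proof -
  obtain k where "n = to_nat (map x [0..<k])" using assms by (auto simp: branch_def)
  then have "\<forall>y. agree k y x \<longrightarrow> n \<in> branch y"
    by (metis agree_def branch_def rangeI)
  then show ?thesis ..
qed

lemma branches_cyl:
  assumes "finite F" "F \<subseteq> branches p"
  shows "\<exists>n. \<forall>q\<in>cyl n p. F \<subseteq> branches q"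
  using assms
proof (induction F)
  case (insert a F)
  then obtain n where n: "\<forall>q\<in>cyl n p. F \<subseteq> branches q" by auto
  have "a \<in> branch (fst p) \<or> a \<in> branch (snd p)"
    using insert.prems by (auto simp: branches_def)
  then obtain k where
    "(\<forall>y. agree k y (fst p) \<longrightarrow> a \<in> branch y) \<or> (\<forall>y. agree k y (snd p) \<longrightarrow> a \<in> branch y)"
    using branch_agree by metis
  then have k: "\<forall>q\<in>cyl k p. a \<in> branches q"
    by (auto simp: branches_def cyl_def)
  have "cyl (max n k) p \<subseteq> cyl n p" "cyl (max n k) p \<subseteq> cyl k p"
    using cyl_subset[OF self_in_cyl] by auto
  with n k show ?case by blast
qed simp

text \<open>This is openness in the Scott topology of the power set. Membership of a node in a
  branch depends on finitely many coordinates, so \<open>P (branches p)\<close> is then an open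
  condition on \<open>p\<close>.\<close>

definition finitary :: "('a set \<Rightarrow> bool) \<Rightarrow> bool" where
  "finitary P \<longleftrightarrow> (\<forall>B. P B \<longrightarrow> (\<exists>F\<subseteq>B. finite F \<and> (\<forall>B'. F \<subseteq> B' \<longrightarrow> P B')))"

lemma finitary_cyl:
  assumes "finitary P" "P (branches p)"
  shows "\<exists>n. \<forall>q\<in>cyl n p. P (branches q)"
  using assms branches_cyl unfolding finitary_def by meson

text \<open>A \<sigma>-ideal that replaces the countable sets of the classical perfect set argument.
  Countability would be the wrong notion: uncountably many pairs may share one point, and no two of
  these are separated.\<close>

definition negligible_pairs :: "('a \<times> 'a) set \<Rightarrow> bool" where
  "negligible_pairs Q \<longleftrightarrow> (\<exists>C. countable C \<and> (\<forall>p\<in>Q. fst p \<in> C \<or> snd p \<in> C))"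

lemma negligible_pairs_subset: "negligible_pairs Q \<Longrightarrow> P \<subseteq> Q \<Longrightarrow> negligible_pairs P"
  unfolding negligible_pairs_def by blast

lemma negligible_pairs_UN:
  assumes "countable I" "\<And>i. i \<in> I \<Longrightarrow> negligible_pairs (Q i)"
  shows "negligible_pairs (\<Union>i\<in>I. Q i)"
proof -
  obtain C where C: "\<And>i. i \<in> I \<Longrightarrow> countable (C i) \<and> (\<forall>p\<in>Q i. fst p \<in> C i \<or> snd p \<in> C i)"
    using assms(2) unfolding negligible_pairs_def by metis
  then show ?thesis
    unfolding negligible_pairs_def using assms(1)
    by (intro exI[of _ "\<Union>i\<in>I. C i"]) auto
qed

lemma negligible_pairs_Un:
  "negligible_pairs P \<Longrightarrow> negligible_pairs Q \<Longrightarrow> negligible_pairs (P \<union> Q)"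
  using negligible_pairs_UN[of UNIV "\<lambda>b::bool. if b then P else Q"] by (simp add: UNIV_bool Un_commute)

text \<open>Otherwise every point of \<open>Q\<close> lies in a cylinder with negligible trace on
  \<open>Q\<close>; there are only countably many cylinders, so \<open>Q\<close> would be
  negligible.\<close>

lemma condensation_pair:
  assumes "\<not> negligible_pairs Q"
  obtains p where "p \<in> Q" "\<And>n. \<not> negligible_pairs (Q \<inter> cyl n p)"
proof (rule ccontr)
  assume "\<not> thesis"
  then have *: "\<exists>n. negligible_pairs (Q \<inter> cyl n p)" if "p \<in> Q" for p
    using that \<open>\<And>p. \<lbrakk>p \<in> Q; \<And>n. \<not> negligible_pairs (Q \<inter> cyl n p)\<rbrakk> \<Longrightarrow> thesis\<close> by blast
  define \<C> where "\<C> = {D \<in> range (\<lambda>(n, p). cyl n p). negligible_pairs (Q \<inter> D)}"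
  have "countable \<C>"
    unfolding \<C>_def by (rule countable_subset[OF _ countable_range_cyl]) auto
  then have "negligible_pairs (\<Union>D\<in>\<C>. Q \<inter> D)"
    by (rule negligible_pairs_UN) (simp add: \<C>_def)
  moreover have "Q \<subseteq> (\<Union>D\<in>\<C>. Q \<inter> D)"
  proof
    fix p assume p: "p \<in> Q"
    then obtain n where "negligible_pairs (Q \<inter> cyl n p)" using * by blast
    then have "cyl n p \<in> \<C>" by (auto simp: \<C>_def)
    with p self_in_cyl show "p \<in> (\<Union>D\<in>\<C>. Q \<inter> D)" by blast
  qed
  ultimately show False using assms negligible_pairs_subset by blast
qed

section \<open>Cantor schemes of separated pairs\<close>

lemma agree_distinct:
  assumes "x \<noteq> y"
  obtains n where "\<And>m. n \<le> m \<Longrightarrow> \<not> agree m x y"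
proof -
  obtain i where "x i \<noteq> y i" using assms by blast
  then have "\<not> agree m x y" if "Suc i \<le> m" for m
    using that Suc_le_eq unfolding agree_iff by blast
  then show thesis by (rule that)
qed

text \<open>A witness for \<open>separated\<close> at a finite level, which passes to all pairs in
  the two cylinders of length \<open>n\<close>.\<close>

definition cyl_separated :: "nat \<Rightarrow> (nat \<Rightarrow> bool) \<times> (nat \<Rightarrow> bool) \<Rightarrow> (nat \<Rightarrow> bool) \<times> (nat \<Rightarrow> bool) \<Rightarrow> bool" where
  "cyl_separated n p q \<longleftrightarrow> (\<forall>x\<in>{fst p, snd p}. \<forall>y\<in>{fst q, snd q}. \<not> agree n x y)"

lemma separated_imp_cyl_separated:
  assumes "separated p q"
  obtains n where "\<And>m. n \<le> m \<Longrightarrow> cyl_separated m p q"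
proof -
  have ne: "fst p \<noteq> fst q" "fst p \<noteq> snd q" "snd p \<noteq> fst q" "snd p \<noteq> snd q"
    using assms by (auto simp: separated_def)
  obtain a where a: "\<And>m. a \<le> m \<Longrightarrow> \<not> agree m (fst p) (fst q)" using agree_distinct[OF ne(1)] by blast
  obtain b where b: "\<And>m. b \<le> m \<Longrightarrow> \<not> agree m (fst p) (snd q)" using agree_distinct[OF ne(2)] by blast
  obtain c where c: "\<And>m. c \<le> m \<Longrightarrow> \<not> agree m (snd p) (fst q)" using agree_distinct[OF ne(3)] by blast
  obtain d where d: "\<And>m. d \<le> m \<Longrightarrow> \<not> agree m (snd p) (snd q)" using agree_distinct[OF ne(4)] by blast
  show thesis
    by (rule that[of "Max {a, b, c, d}"]) (use a b c d in \<open>auto simp: cyl_separated_def\<close>)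
qed

lemma cyl_separated_imp_separated:
  assumes "cyl_separated n p q" "p' \<in> cyl n p" "q' \<in> cyl n q"
  shows "separated p' q'"
proof -
  have *: "x' \<noteq> y'" if "agree n x' x" "agree n y' y" "\<not> agree n x y" for x x' y y'
    using that by (auto simp: agree_def)
  have "fst p' \<noteq> fst q'" "fst p' \<noteq> snd q'" "snd p' \<noteq> fst q'" "snd p' \<noteq> snd q'"
    using *[of "fst p'" "fst p" "fst q'" "fst q"] *[of "fst p'" "fst p" "snd q'" "snd q"]
      *[of "snd p'" "snd p" "fst q'" "fst q"] *[of "snd p'" "snd p" "snd q'" "snd q"] assms
    by (auto simp: cyl_separated_def cyl_def)
  then show ?thesis by (auto simp: separated_def)
qed

text \<open>
  The splitting step of a Cantor scheme in which the part of \<open>Q\<close> inside every cylinder of the scheme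
  is not negligible.
\<close>

lemma split_pair:
  assumes fin: "finitary P" and nn: "\<not> negligible_pairs (Q \<inter> cyl n p)"
    and Q: "\<And>q. q \<in> Q \<Longrightarrow> fst q \<noteq> snd q \<and> P (branches q)"
  shows "\<exists>p\<^sub>1 p\<^sub>2 m. n < m \<and> cyl_separated m p\<^sub>1 p\<^sub>2 \<and>
    (\<forall>p'\<in>{p\<^sub>1, p\<^sub>2}. p' \<in> cyl n p \<and> \<not> negligible_pairs (Q \<inter> cyl m p') \<and>
       \<not> agree m (fst p') (snd p') \<and> (\<forall>q\<in>cyl m p'. P (branches q)))"
proof -
  have ex: "\<exists>m. n < m \<and> \<not> agree m (fst q) (snd q) \<and> (\<forall>q'\<in>cyl m q. P (branches q'))"
    if q: "q \<in> Q \<inter> cyl n p" for q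
  proof -
    have ne: "fst q \<noteq> snd q" and Pq: "P (branches q)" using q Q by auto
    obtain a where a: "\<And>m. a \<le> m \<Longrightarrow> \<not> agree m (fst q) (snd q)"
      using agree_distinct[OF ne] by blast
    obtain b where b: "\<forall>q'\<in>cyl b q. P (branches q')"
      using finitary_cyl[OF fin Pq] by blast
    let ?m = "Max {a, b, Suc n}"
    have "cyl ?m q \<subseteq> cyl b q" by (rule cyl_subset[OF self_in_cyl]) simp
    then have "n < ?m \<and> \<not> agree ?m (fst q) (snd q) \<and> (\<forall>q'\<in>cyl ?m q. P (branches q'))"
      using a[of ?m] b by auto
    then show ?thesis ..
  qed
  obtain p\<^sub>1 where p1: "p\<^sub>1 \<in> Q \<inter> cyl n p" "\<And>m. \<not> negligible_pairs (Q \<inter> cyl n p \<inter> cyl m p\<^sub>1)"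
    using condensation_pair[OF nn] by blast
  \<comment> \<open>The pairs that share a point with \<open>p\<^sub>1\<close> are negligible, being
    met by two points; without them a second condensation pair exists and is separated from
    \<open>p\<^sub>1\<close>.\<close>
  define Q' where "Q' = {q \<in> Q \<inter> cyl n p. separated p\<^sub>1 q}"
  have "negligible_pairs (Q \<inter> cyl n p - Q')"
    unfolding negligible_pairs_def Q'_def separated_def
    by (intro exI[of _ "{fst p\<^sub>1, snd p\<^sub>1}"]) auto
  then have "\<not> negligible_pairs Q'"
    using nn negligible_pairs_Un[of "Q \<inter> cyl n p - Q'" Q']
      negligible_pairs_subset[of "Q \<inter> cyl n p - Q' \<union> Q'" "Q \<inter> cyl n p"] by blast
  then obtain p\<^sub>2 where p2: "p\<^sub>2 \<in> Q'" "\<And>m. \<not> negligible_pairs (Q' \<inter> cyl m p\<^sub>2)"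
    using condensation_pair by blast
  have big: "\<not> negligible_pairs (Q \<inter> cyl m p\<^sub>1)" "\<not> negligible_pairs (Q \<inter> cyl m p\<^sub>2)" for m
  proof -
    have "Q \<inter> cyl n p \<inter> cyl m p\<^sub>1 \<subseteq> Q \<inter> cyl m p\<^sub>1" by blast
    then show "\<not> negligible_pairs (Q \<inter> cyl m p\<^sub>1)"
      using p1(2)[of m] negligible_pairs_subset by blast
    have "Q' \<inter> cyl m p\<^sub>2 \<subseteq> Q \<inter> cyl m p\<^sub>2" by (auto simp: Q'_def)
    then show "\<not> negligible_pairs (Q \<inter> cyl m p\<^sub>2)"
      using p2(2)[of m] negligible_pairs_subset by blast
  qed
  have p2': "p\<^sub>2 \<in> Q \<inter> cyl n p" "separated p\<^sub>1 p\<^sub>2" using p2(1) by (auto simp: Q'_def)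
  obtain m1 where m1: "n < m1" "\<not> agree m1 (fst p\<^sub>1) (snd p\<^sub>1)" "\<forall>q'\<in>cyl m1 p\<^sub>1. P (branches q')"
    using ex[OF p1(1)] by blast
  obtain m2 where m2: "n < m2" "\<not> agree m2 (fst p\<^sub>2) (snd p\<^sub>2)" "\<forall>q'\<in>cyl m2 p\<^sub>2. P (branches q')"
    using ex[OF p2'(1)] by blast
  obtain m3 where m3: "\<And>m. m3 \<le> m \<Longrightarrow> cyl_separated m p\<^sub>1 p\<^sub>2"
    using separated_imp_cyl_separated[OF p2'(2)] by blast
  let ?m = "Max {m1, m2, m3}"
  have c: "cyl ?m p\<^sub>1 \<subseteq> cyl m1 p\<^sub>1" "cyl ?m p\<^sub>2 \<subseteq> cyl m2 p\<^sub>2"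
    by (rule cyl_subset[OF self_in_cyl]; simp)+
  have g: "\<not> agree ?m (fst p\<^sub>1) (snd p\<^sub>1)" "\<not> agree ?m (fst p\<^sub>2) (snd p\<^sub>2)"
    using m1(2) m2(2) agree_mono[of ?m _ _ m1] agree_mono[of ?m _ _ m2] by auto
  show ?thesis
    by (rule exI[of _ p\<^sub>1], rule exI[of _ p\<^sub>2], rule exI[of _ ?m])
      (use m1 m2 m3[of ?m] c g big p1(1) p2'(1) in auto)
qed

text \<open>A perfect set theorem for a G-delta condition. Level \<open>k\<close> of the scheme
  secures \<open>R k\<close> on a whole cylinder, so the limit pairs inherit every
  \<open>R k\<close> although they need not be among the pairs that name the cylinders.\<close>

lemma perfect_family_of_pairs:
  fixes R :: "nat \<Rightarrow> nat set \<Rightarrow> bool"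
  assumes fin: "\<And>k. finitary (R k)"
    and nn: "\<not> negligible_pairs {p. fst p \<noteq> snd p \<and> (\<forall>k. R k (branches p))}"
  obtains q :: "(nat \<Rightarrow> bool) \<Rightarrow> (nat \<Rightarrow> bool) \<times> (nat \<Rightarrow> bool)"
  where "\<And>z. fst (q z) \<noteq> snd (q z)" "\<And>z k. R k (branches (q z))"
    "\<And>z z'. z \<noteq> z' \<Longrightarrow> separated (q z) (q z')"
proof -
  define Q where "Q = {p. fst p \<noteq> snd p \<and> (\<forall>k. R k (branches p))}"
  define ok where "ok k n p p\<^sub>1 p\<^sub>2 m \<longleftrightarrow> n < m \<and> cyl_separated m p\<^sub>1 p\<^sub>2 \<and>
    (\<forall>p'\<in>{p\<^sub>1, p\<^sub>2}. p' \<in> cyl n p \<and> \<not> negligible_pairs (Q \<inter> cyl m p') \<and>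
       \<not> agree m (fst p') (snd p') \<and> (\<forall>q\<in>cyl m p'. R k (branches q)))" for k n p p\<^sub>1 p\<^sub>2 m
  \<comment> \<open>The choice depends on \<open>k\<close>, \<open>n\<close> and \<open>p\<close>
    but not on the sequence \<open>z\<close>, so sequences with a common initial segment run through
    the same states along it.\<close>
  define t where "t k n p = (SOME t. ok k n p (fst t) (fst (snd t)) (snd (snd t)))" for k n p
  define f\<^sub>1 f\<^sub>2 h where "f\<^sub>1 k n p = fst (t k n p)" and "f\<^sub>2 k n p = fst (snd (t k n p))"
    and "h k n p = snd (snd (t k n p))" for k n p
  have f: "ok k n p (f\<^sub>1 k n p) (f\<^sub>2 k n p) (h k n p)" if "\<not> negligible_pairs (Q \<inter> cyl n p)" for k n p
  proof -
    have "\<exists>p\<^sub>1 p\<^sub>2 m. ok k n p p\<^sub>1 p\<^sub>2 m"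
      unfolding ok_def by (rule split_pair[OF fin that]) (simp add: Q_def)
    then have "\<exists>t. ok k n p (fst t) (fst (snd t)) (snd (snd t))" by auto
    from someI_ex[OF this] show ?thesis by (simp add: t_def f\<^sub>1_def f\<^sub>2_def h_def)
  qed
  \<comment> \<open>A cylinder of length 0 is the whole space, whichever pair names it; hence the
    default \<open>undefined\<close>.\<close>
  define st where "st z = rec_nat (undefined, 0)
    (\<lambda>k (p, n). (if z k then f\<^sub>1 k n p else f\<^sub>2 k n p, h k n p))" for z :: "nat \<Rightarrow> bool"
  define pt ln where "pt z k = fst (st z k)" and "ln z k = snd (st z k)" for z k
  have st_Suc: "pt z (Suc k) = (if z k then f\<^sub>1 k (ln z k) (pt z k) else f\<^sub>2 k (ln z k) (pt z k))"
      "ln z (Suc k) = h k (ln z k) (pt z k)" for z k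
    by (simp_all add: st_def pt_def ln_def split: prod.splits)
  have big: "\<not> negligible_pairs (Q \<inter> cyl (ln z k) (pt z k))" for z k
  proof (induction k)
    case 0
    have "cyl 0 p = UNIV" for p by (auto simp: cyl_def agree_def)
    then show ?case using nn by (simp add: st_def ln_def Q_def)
  next
    case (Suc k)
    from f[OF Suc, of k] show ?case by (simp add: st_Suc ok_def)
  qed
  have ok: "ok k (ln z k) (pt z k) (f\<^sub>1 k (ln z k) (pt z k)) (f\<^sub>2 k (ln z k) (pt z k)) (ln z (Suc k))" for z k
    using f[OF big] by (simp add: st_Suc)
  have step: "pt z (Suc k) \<in> cyl (ln z k) (pt z k)" "ln z k < ln z (Suc k)"
    "\<not> agree (ln z (Suc k)) (fst (pt z (Suc k))) (snd (pt z (Suc k)))"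
    "\<forall>q\<in>cyl (ln z (Suc k)) (pt z (Suc k)). R k (branches q)" for z k
  proof -
    have "pt z (Suc k) \<in> {f\<^sub>1 k (ln z k) (pt z k), f\<^sub>2 k (ln z k) (pt z k)}"
      by (simp add: st_Suc(1))
    with ok[of k z] show "pt z (Suc k) \<in> cyl (ln z k) (pt z k)" "ln z k < ln z (Suc k)"
      "\<not> agree (ln z (Suc k)) (fst (pt z (Suc k))) (snd (pt z (Suc k)))"
      "\<forall>q\<in>cyl (ln z (Suc k)) (pt z (Suc k)). R k (branches q)"
      unfolding ok_def by blast+
  qed
  have ln_mono: "ln z k \<le> ln z l" if "k \<le> l" for z k l
    by (rule lift_Suc_mono_le[of "ln z", OF less_imp_le[OF step(2)] that])
  have ln_ge: "k \<le> ln z k" for z k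
  proof (induction k)
    case (Suc k)
    then show ?case using step(2)[of z k] by linarith
  qed simp
  have in_cyl: "pt z l \<in> cyl (ln z k) (pt z k)" if "k \<le> l" for z k l
    using that
  proof (induction rule: dec_induct)
    case base
    show ?case by (rule self_in_cyl)
  next
    case (step n)
    have "cyl (ln z n) (pt z n) \<subseteq> cyl (ln z k) (pt z k)"
      by (rule cyl_subset[OF step.IH ln_mono]) (rule step.hyps)
    with \<open>\<And>z k. pt z (Suc k) \<in> cyl (ln z k) (pt z k)\<close> show ?case by blast
  qed
  \<comment> \<open>Coordinate \<open>i\<close> is read off at stage \<open>Suc i\<close>, whose
    cylinder has length at least \<open>Suc i\<close> and therefore fixes it for all later
    stages.\<close>
  define q where "q z = (\<lambda>i. fst (pt z (Suc i)) i, \<lambda>i. snd (pt z (Suc i)) i)" for z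
  have q_cyl: "q z \<in> cyl (ln z k) (pt z k)" for z k
  proof -
    have "fst (pt z (Suc i)) i = fst (pt z k) i \<and> snd (pt z (Suc i)) i = snd (pt z k) i" if "i < ln z k" for i
    proof (cases "k \<le> Suc i")
      case True
      from in_cyl[OF this, of z] that show ?thesis by (simp add: cyl_def agree_iff)
    next
      case False
      then have "Suc i \<le> k" by simp
      from in_cyl[OF this, of z] ln_ge[of "Suc i" z] show ?thesis by (simp add: cyl_def agree_iff)
    qed
    then show ?thesis by (simp add: cyl_def agree_iff q_def)
  qed
  show thesis
  proof
    fix z
    show "fst (q z) \<noteq> snd (q z)"
      using q_cyl[of z "Suc 0"] step(3)[of z 0] by (auto simp: cyl_def agree_def)
    show "R k (branches (q z))" for k
      using step(4) q_cyl by blast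
    fix z' :: "nat \<Rightarrow> bool" assume "z \<noteq> z'"
    then have ex: "\<exists>k. z k \<noteq> z' k" by blast
    \<comment> \<open>At the first difference the two sequences take the two children of one common
      state, and these lie in separated cylinders.\<close>
    define k where "k = (LEAST k. z k \<noteq> z' k)"
    have k: "z k \<noteq> z' k" unfolding k_def using ex by (rule LeastI_ex)
    have below: "z i = z' i" if "i < k" for i
      using not_less_Least[OF that[unfolded k_def]] by simp
    have "st z j = st z' j" if "j \<le> k" for j
      using that by (induction j) (simp_all add: st_def below)
    then have eq: "pt z k = pt z' k" "ln z k = ln z' k" by (simp_all add: pt_def ln_def)
    then have eq': "ln z (Suc k) = ln z' (Suc k)" by (simp add: st_Suc)
    have sym: "cyl_separated n a b \<Longrightarrow> cyl_separated n b a" for n a b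
      by (auto simp: cyl_separated_def agree_def)
    have "cyl_separated (ln z (Suc k)) (pt z (Suc k)) (pt z' (Suc k))"
      using ok[of k z] k sym by (auto simp: ok_def st_Suc(1) eq)
    then show "separated (q z) (q z')"
      by (rule cyl_separated_imp_separated) (use q_cyl[of z "Suc k"] q_cyl[of z' "Suc k"] eq' in auto)
  qed
qed

section \<open>Matrices with absolutely summable rows\<close>

text \<open>The trace on the isolated points of the neighbourhood filter of the point
  \<open>Inr A\<close>: continuity at that point is convergence along \<open>A\<close>.\<close>

abbreviation along :: "nat set \<Rightarrow> nat filter" where
  "along A \<equiv> inf sequentially (principal A)"

lemma along_mono: "A \<subseteq> B \<Longrightarrow> along A \<le> along B"
  by (intro inf_mono) auto

lemma along_neq_bot: "infinite A \<Longrightarrow> along A \<noteq> bot"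
  by (auto simp: trivial_limit_def eventually_inf_principal eventually_sequentially infinite_nat_iff_unbounded_le)

lemma eventually_along: "eventually P (along A) \<longleftrightarrow> (\<exists>N. \<forall>n\<in>A. N \<le> n \<longrightarrow> P n)"
  by (auto simp: eventually_inf_principal eventually_sequentially)

lemma tendsto_along_iff:
  fixes g :: "nat \<Rightarrow> 'k::real_normed_vector"
  shows "(g \<longlongrightarrow> l) (along A) \<longleftrightarrow> (\<forall>\<epsilon>>0. \<exists>N. \<forall>n\<in>A. N \<le> n \<longrightarrow> norm (g n - l) < \<epsilon>)"
  by (simp add: tendsto_iff eventually_along dist_norm)

lemma eventually_along_notin:
  assumes "finite (A \<inter> B)"
  shows "eventually (\<lambda>n. n \<notin> A) (along B)"
proof -
  obtain N where "\<forall>n\<in>A \<inter> B. n < N"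
    using finite_nat_set_iff_bounded assms by blast
  then have "\<forall>n\<in>B. N \<le> n \<longrightarrow> n \<notin> A" by (meson IntI not_less)
  then show ?thesis unfolding eventually_along by blast
qed

lemma finite_large_along:
  fixes g :: "nat \<Rightarrow> 'k::real_normed_vector"
  assumes "(g \<longlongrightarrow> l) (along A)" "\<epsilon> > 0"
  shows "finite {n \<in> A. \<epsilon> \<le> norm (g n - l)}"
proof -
  obtain N where "\<forall>n\<in>A. N \<le> n \<longrightarrow> norm (g n - l) < \<epsilon>"
    using assms unfolding tendsto_along_iff by blast
  then have "{n \<in> A. \<epsilon> \<le> norm (g n - l)} \<subseteq> {..<N}" by (force simp: not_le[symmetric])
  then show ?thesis by (rule finite_subset) simp
qed

lemma along_Un: "along (A \<union> B) = sup (along A) (along B)"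
  by (simp add: inf_sup_distrib1 flip: sup_principal)

section \<open>Null columns, tameness and its failure as a countable union of G-delta
  conditions\<close>

definition abs_summable_rows :: "(nat \<Rightarrow> nat \<Rightarrow> 'k::real_normed_vector) \<Rightarrow> bool" where
  "abs_summable_rows M \<longleftrightarrow> (\<forall>n. M n abs_summable_on UNIV)"

definition row_sum :: "(nat \<Rightarrow> nat \<Rightarrow> 'k::real_normed_vector) \<Rightarrow> nat set \<Rightarrow> nat \<Rightarrow> 'k" where
  "row_sum M A n = (\<Sum>\<^sub>\<infinity>m\<in>A. M n m)"

definition null_columns :: "(nat \<Rightarrow> nat \<Rightarrow> 'k::real_normed_vector) \<Rightarrow> nat set \<Rightarrow> bool" where
  "null_columns M B \<longleftrightarrow> (\<forall>m. ((\<lambda>n. M n m) \<longlongrightarrow> 0) (along B))"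

text \<open>
  If \<open>M\<close> is the matrix of an operator on \<open>C\<^sub>0(K\<^sub>\<A>)\<close>, then only countably many \<open>A \<in> \<A>\<close> kill \<open>M\<close>.
\<close>

definition kills :: "nat set \<Rightarrow> (nat \<Rightarrow> nat \<Rightarrow> 'k::real_normed_vector) \<Rightarrow> bool" where
  "kills A M \<longleftrightarrow> \<not> (null_columns M A \<and> (\<exists>l. (row_sum M A \<longlongrightarrow> l) (along A)))"

text \<open>The block contains the row index because convergence of \<open>row_sum M A\<close> along
  \<open>A\<close> is tested only in rows \<open>n\<close> with \<open>n\<close> in
  \<open>A\<close>; the block is a finite approximation of such an \<open>A\<close>.\<close>

definition admissible :: "nat set \<Rightarrow> nat \<Rightarrow> nat \<Rightarrow> nat set \<Rightarrow> bool" where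
  "admissible B N n G \<longleftrightarrow> finite G \<and> n \<in> G \<and> G \<subseteq> B \<inter> {N..}"

lemma admissible_mono: "admissible B N n G \<Longrightarrow> B \<subseteq> B' \<Longrightarrow> N' \<le> N \<Longrightarrow> admissible B' N' n G"
  by (force simp: admissible_def)

lemma admissible_ge: "admissible B N n G \<Longrightarrow> N \<le> n \<and> n \<in> B"
  by (force simp: admissible_def)

text \<open>A Cauchy criterion that expresses asymptotic scalarity on \<open>B\<close>. The blocks
  \<open>{n}\<close> and \<open>{n'}\<close> make the diagonal converge; the blocks
  \<open>{n}\<close> and \<open>insert n F\<close> with the same row make the sums off the diagonal
  small.\<close>

definition tame :: "(nat \<Rightarrow> nat \<Rightarrow> 'k::real_normed_vector) \<Rightarrow> nat set \<Rightarrow> bool" where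
  "tame M B \<longleftrightarrow> null_columns M B \<and>
     (\<forall>\<epsilon>>0. \<exists>N. \<forall>n n' G G'. admissible B N n G \<longrightarrow> admissible B N n' G' \<longrightarrow>
        norm (sum (M n) G - sum (M n') G') < \<epsilon>)"

lemma null_columns_mono: "null_columns M B \<Longrightarrow> A \<subseteq> B \<Longrightarrow> null_columns M A"
  unfolding null_columns_def using tendsto_mono[OF along_mono] by blast

lemma tame_mono: "tame M B \<Longrightarrow> A \<subseteq> B \<Longrightarrow> tame M A"
  unfolding tame_def using null_columns_mono admissible_mono[of A _ _ _ B] by (meson order_refl)

text \<open>
  Failure of tameness is a countable union, over \<open>i\<close>, of countable intersections, over \<open>N\<close>, of the
  open conditions \<open>wild_at M i N\<close>; the index \<open>(Some m, k)\<close> refers to the \<open>m\<close>-th column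
  and \<open>(None, k)\<close> to the oscillation of the block sums.
\<close>

definition wild_at :: "(nat \<Rightarrow> nat \<Rightarrow> 'k::real_normed_vector) \<Rightarrow> nat option \<times> nat \<Rightarrow> nat \<Rightarrow> nat set \<Rightarrow> bool" where
  "wild_at M i N B = (case i of
     (Some m, k) \<Rightarrow> \<exists>n\<in>B. N \<le> n \<and> inverse (Suc k) \<le> norm (M n m)
   | (None, k) \<Rightarrow> \<exists>n n' G G'. admissible B N n G \<and> admissible B N n' G' \<and>
        inverse (Suc k) \<le> norm (sum (M n) G - sum (M n') G'))"

lemma finitary_wild_at: "finitary (wild_at M i N)"
  unfolding finitary_def
proof (intro allI impI)
  fix B assume w: "wild_at M i N B"
  obtain j k where i: "i = (j, k)" by (cases i)
  show "\<exists>F\<subseteq>B. finite F \<and> (\<forall>B'. F \<subseteq> B' \<longrightarrow> wild_at M i N B')"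
  proof (cases j)
    case None
    then obtain n n' G G' where *: "admissible B N n G" "admissible B N n' G'"
      "inverse (Suc k) \<le> norm (sum (M n) G - sum (M n') G')"
      using w i by (auto simp: wild_at_def)
    have "wild_at M i N B'" if "G \<union> G' \<subseteq> B'" for B'
    proof -
      have "admissible B' N n G" "admissible B' N n' G'"
        using * that by (auto simp: admissible_def)
      with *(3) show ?thesis unfolding wild_at_def i None prod.case option.case by blast
    qed
    moreover have "G \<union> G' \<subseteq> B" "finite (G \<union> G')" using * by (auto simp: admissible_def)
    ultimately show ?thesis by blast
  next
    case (Some m)
    then obtain n where "n \<in> B" "N \<le> n" "inverse (Suc k) \<le> norm (M n m)"
      using w i by (auto simp: wild_at_def)
    then show ?thesis
      using Some i by (intro exI[of _ "{n}"]) (auto simp: wild_at_def)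
  qed
qed

lemma not_tame_iff: "\<not> tame M B \<longleftrightarrow> (\<exists>i. \<forall>N. wild_at M i N B)"
proof -
  have inv: "(\<exists>\<epsilon>>0. Q \<epsilon>) \<longleftrightarrow> (\<exists>k. Q (inverse (real (Suc k))))"
    if "\<And>\<epsilon> \<delta>. Q \<epsilon> \<Longrightarrow> \<delta> \<le> \<epsilon> \<Longrightarrow> Q \<delta>" for Q :: "real \<Rightarrow> bool"
  proof
    assume "\<exists>\<epsilon>>0. Q \<epsilon>"
    then obtain \<epsilon> where e: "\<epsilon> > 0" "Q \<epsilon>" by blast
    obtain k where "inverse (real (Suc k)) < \<epsilon>" using reals_Archimedean[OF e(1)] by blast
    with that e(2) less_imp_le show "\<exists>k. Q (inverse (real (Suc k)))" by blast
  next
    assume "\<exists>k. Q (inverse (real (Suc k)))"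
    then obtain k where "Q (inverse (real (Suc k)))" ..
    then show "\<exists>\<epsilon>>0. Q \<epsilon>" by (intro exI[of _ "inverse (real (Suc k))"]) simp
  qed
  have "\<not> null_columns M B \<longleftrightarrow> (\<exists>m. \<exists>\<epsilon>>0. \<forall>N. \<exists>n\<in>B. N \<le> n \<and> \<epsilon> \<le> norm (M n m))"
    by (simp add: null_columns_def tendsto_along_iff) (meson not_le)
  also have "\<dots> \<longleftrightarrow> (\<exists>m k. \<forall>N. wild_at M (Some m, k) N B)"
    unfolding wild_at_def prod.case option.case by (subst inv) (meson order.trans)+
  finally have 1: "\<not> null_columns M B \<longleftrightarrow> (\<exists>m k. \<forall>N. wild_at M (Some m, k) N B)" .
  have "\<not> (\<forall>\<epsilon>>0. \<exists>N. \<forall>n n' G G'. admissible B N n G \<longrightarrow> admissible B N n' G' \<longrightarrow>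
        norm (sum (M n) G - sum (M n') G') < \<epsilon>) \<longleftrightarrow>
      (\<exists>\<epsilon>>0. \<forall>N. \<exists>n n' G G'. admissible B N n G \<and> admissible B N n' G' \<and>
        \<epsilon> \<le> norm (sum (M n) G - sum (M n') G'))"
    by (meson not_le)
  also have "\<dots> \<longleftrightarrow> (\<exists>k. \<forall>N. wild_at M (None, k) N B)"
    unfolding wild_at_def prod.case option.case by (subst inv) (meson order.trans)+
  finally have 2: "\<not> (\<forall>\<epsilon>>0. \<exists>N. \<forall>n n' G G'. admissible B N n G \<longrightarrow> admissible B N n' G' \<longrightarrow>
        norm (sum (M n) G - sum (M n') G') < \<epsilon>) \<longleftrightarrow> (\<exists>k. \<forall>N. wild_at M (None, k) N B)" .
  show ?thesis
    unfolding tame_def de_Morgan_conj 1 2 by (metis not_None_eq surj_pair)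
qed

section \<open>Row sums, consequences of tameness, and killing subsets\<close>

lemma norm_infsum_le_of_finite:
  fixes f :: "'a \<Rightarrow> 'k::real_normed_vector"
  assumes "f summable_on A" "\<And>F. finite F \<Longrightarrow> F \<subseteq> A \<Longrightarrow> norm (sum f F) \<le> \<epsilon>"
  shows "norm (infsum f A) \<le> \<epsilon>"
proof -
  have "(sum f \<longlongrightarrow> infsum f A) (finite_subsets_at_top A)"
    using has_sum_infsum[OF assms(1)] by (simp add: has_sum_def)
  then show ?thesis
    by (rule tendsto_upperbound[OF tendsto_norm])
      (auto intro!: eventually_finite_subsets_at_top_weakI assms(2))
qed

context
  fixes M :: "nat \<Rightarrow> nat \<Rightarrow> 'k::banach"
  assumes M: "abs_summable_rows M"
begin

lemma abs_summable_row: "M n abs_summable_on A"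
  using M unfolding abs_summable_rows_def by (meson summable_on_subset_banach subset_UNIV)

lemma summable_row: "M n summable_on A"
  by (rule abs_summable_summable[OF abs_summable_row])

lemma row_sum_Un: "A \<inter> B = {} \<Longrightarrow> row_sum M (A \<union> B) n = row_sum M A n + row_sum M B n"
  unfolding row_sum_def by (intro infsum_Un_disjoint summable_row)

lemma row_sum_finite: "finite A \<Longrightarrow> row_sum M A n = sum (M n) A"
  by (simp add: row_sum_def)

lemma small_tail:
  assumes "\<epsilon> > 0"
  shows "\<exists>L. \<forall>A. A \<subseteq> {L..} \<longrightarrow> norm (row_sum M A n) \<le> \<epsilon>"
proof -
  obtain F where F: "finite F" "dist (\<Sum>m\<in>F. norm (M n m)) (\<Sum>\<^sub>\<infinity>m. norm (M n m)) \<le> \<epsilon>"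
    using infsum_finite_approximation[OF abs_summable_row[of n UNIV] assms] by blast
  obtain L where L: "F \<subseteq> {..<L}"
    using F(1) finite_nat_iff_bounded by blast
  have "norm (row_sum M A n) \<le> \<epsilon>" if A: "A \<subseteq> {L..}" for A
  proof -
    have "norm (row_sum M A n) \<le> (\<Sum>\<^sub>\<infinity>m\<in>A. norm (M n m))"
      unfolding row_sum_def by (rule norm_infsum_bound[OF abs_summable_row])
    also have "\<dots> = (\<Sum>\<^sub>\<infinity>m\<in>F \<union> A. norm (M n m)) - (\<Sum>m\<in>F. norm (M n m))"
    proof -
      have "F \<inter> A = {}" using A L by force
      then show ?thesis
        using infsum_Un_disjoint[OF abs_summable_row[of n F] abs_summable_row[of n A]] F(1) by simp
    qed
    also have "\<dots> \<le> (\<Sum>\<^sub>\<infinity>m. norm (M n m)) - (\<Sum>m\<in>F. norm (M n m))"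
      using infsum_mono2[OF abs_summable_row[of n "F \<union> A"] abs_summable_row[of n UNIV]] by auto
    also have "\<dots> \<le> \<epsilon>" using F(2) by (auto simp: dist_real_def)
    finally show ?thesis .
  qed
  then show ?thesis by blast
qed

text \<open>The bound is uniform in \<open>A\<close> because all these row sums are dominated by the
  sum of the norms in the first \<open>K\<close> columns, a finite sum of null sequences.\<close>

lemma null_columns_head:
  assumes "null_columns M B" "\<epsilon> > 0"
  shows "\<exists>N. \<forall>n\<in>B. N \<le> n \<longrightarrow> (\<forall>A\<subseteq>{..<K}. norm (row_sum M A n) < \<epsilon>)"
proof -
  have "((\<lambda>n. \<Sum>m<K. norm (M n m)) \<longlongrightarrow> (\<Sum>m<K. norm (0::'k))) (along B)"
    using assms(1) unfolding null_columns_def by (intro tendsto_sum tendsto_norm) auto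
  then obtain N where N: "\<And>n. n \<in> B \<Longrightarrow> N \<le> n \<Longrightarrow> (\<Sum>m<K. norm (M n m)) < \<epsilon>"
    using assms(2) by (fastforce simp: tendsto_along_iff)
  have "norm (row_sum M A n) < \<epsilon>" if "n \<in> B" "N \<le> n" "A \<subseteq> {..<K}" for n A
  proof -
    have "finite A" using that(3) finite_subset by blast
    then have "norm (row_sum M A n) \<le> (\<Sum>m\<in>A. norm (M n m))"
      by (simp add: row_sum_finite norm_sum)
    also have "\<dots> \<le> (\<Sum>m<K. norm (M n m))" using that(3) by (intro sum_mono2) auto
    finally show ?thesis using N[OF that(1,2)] by simp
  qed
  then show ?thesis by blast
qed

text \<open>Within row \<open>n\<close>, the blocks \<open>insert n F\<close> and \<open>{n}\<close>
  differ by the sum over \<open>F\<close>, which controls the part beyond \<open>N\<close>; null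
  columns control the part below. The index \<open>n\<close> runs through all of \<open>B\<close>
  and may lie outside \<open>D\<close>, which later gives the interaction of different
  branches.\<close>

lemma tame_off_diagonal:
  assumes "tame M B" "D \<subseteq> B"
  shows "((\<lambda>n. row_sum M (D - {n}) n) \<longlongrightarrow> 0) (along B)"
  unfolding tendsto_along_iff
proof (intro allI impI)
  fix \<epsilon> :: real assume e: "\<epsilon> > 0"
  then have "\<epsilon> / 2 > 0" by simp
  then obtain N where N: "\<And>n n' G G'. admissible B N n G \<Longrightarrow> admissible B N n' G' \<Longrightarrow>
        norm (sum (M n) G - sum (M n') G') < \<epsilon> / 2"
    using assms(1) unfolding tame_def by metis
  obtain N' where N': "\<And>n A. n \<in> B \<Longrightarrow> N' \<le> n \<Longrightarrow> A \<subseteq> {..<N} \<Longrightarrow> norm (row_sum M A n) < \<epsilon> / 2"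
    using null_columns_head[of B "\<epsilon> / 2" N] assms(1) e unfolding tame_def by auto
  have "norm (row_sum M (D - {n}) n - 0) < \<epsilon>" if n: "n \<in> B" "max N N' \<le> n" for n
  proof -
    have *: "D - {n} = (D - {n}) \<inter> {..<N} \<union> (D - {n}) \<inter> {N..}" by auto
    have "norm (sum (M n) F) \<le> \<epsilon> / 2" if F: "finite F" "F \<subseteq> (D - {n}) \<inter> {N..}" for F
    proof -
      have "admissible B N n (insert n F)" "admissible B N n {n}"
        using F n assms(2) by (auto simp: admissible_def)
      moreover have "n \<notin> F" using F(2) by auto
      ultimately show ?thesis using N[of n "insert n F" n "{n}"] F(1) by simp
    qed
    then have "norm (row_sum M ((D - {n}) \<inter> {N..}) n) \<le> \<epsilon> / 2"
      unfolding row_sum_def by (intro norm_infsum_le_of_finite summable_row)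
    moreover have "norm (row_sum M ((D - {n}) \<inter> {..<N}) n) < \<epsilon> / 2"
      using n by (intro N') auto
    moreover have "row_sum M (D - {n}) n = row_sum M ((D - {n}) \<inter> {..<N}) n + row_sum M ((D - {n}) \<inter> {N..}) n"
      by (subst *, rule row_sum_Un) auto
    ultimately show ?thesis
      using norm_triangle_ineq[of "row_sum M ((D - {n}) \<inter> {..<N}) n" "row_sum M ((D - {n}) \<inter> {N..}) n"]
      by simp
  qed
  then show "\<exists>N. \<forall>n\<in>B. N \<le> n \<longrightarrow> norm (row_sum M (D - {n}) n - 0) < \<epsilon>" by blast
qed

text \<open>Singleton blocks make the diagonal Cauchy along \<open>B\<close>; the limit is found
  along the increasing enumeration of \<open>B\<close>.\<close>

lemma tame_diagonal:
  assumes "tame M B" "infinite B"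
  obtains l where "((\<lambda>n. M n n) \<longlongrightarrow> l) (along B)"
proof -
  have C: "\<exists>N. \<forall>n\<in>B. \<forall>n'\<in>B. N \<le> n \<longrightarrow> N \<le> n' \<longrightarrow> norm (M n n - M n' n') < \<epsilon>" if e: "\<epsilon> > 0" for \<epsilon>
  proof -
    obtain N where N: "\<And>n n' G G'. admissible B N n G \<Longrightarrow> admissible B N n' G' \<Longrightarrow>
        norm (sum (M n) G - sum (M n') G') < \<epsilon>"
      using assms(1) e unfolding tame_def by metis
    have "norm (M n n - M n' n') < \<epsilon>" if "n \<in> B" "n' \<in> B" "N \<le> n" "N \<le> n'" for n n'
      using N[of n "{n}" n' "{n'}"] that by (simp add: admissible_def)
    then show ?thesis by blast
  qed
  define X where "X k = M (enumerate B k) (enumerate B k)" for k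
  have en: "enumerate B k \<in> B" "k \<le> enumerate B k" for k
    using assms(2) by (auto simp: enumerate_in_set le_enumerate)
  have "Cauchy X"
    unfolding Cauchy_def X_def dist_norm using C en by (meson order.trans)
  then obtain l where l: "X \<longlonglongrightarrow> l" using Cauchy_convergent convergent_def by blast
  have "((\<lambda>n. M n n) \<longlongrightarrow> l) (along B)"
    unfolding tendsto_along_iff
  proof (intro allI impI)
    fix \<epsilon> :: real assume e: "\<epsilon> > 0"
    obtain N where N: "\<And>n n'. n \<in> B \<Longrightarrow> n' \<in> B \<Longrightarrow> N \<le> n \<Longrightarrow> N \<le> n' \<Longrightarrow> norm (M n n - M n' n') < \<epsilon> / 2"
      using C[of "\<epsilon> / 2"] e by auto
    have "norm (M n n - l) < \<epsilon>" if n: "n \<in> B" "N \<le> n" for n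
    proof -
      have "(\<lambda>k. norm (M n n - X k)) \<longlonglongrightarrow> norm (M n n - l)"
        by (intro tendsto_intros l)
      moreover have "eventually (\<lambda>k. norm (M n n - X k) \<le> \<epsilon> / 2) sequentially"
        unfolding X_def using eventually_ge_at_top[of N]
        by eventually_elim (use N n en order.trans less_imp_le in metis)
      ultimately have "norm (M n n - l) \<le> \<epsilon> / 2"
        by (rule tendsto_upperbound) simp
      with e show ?thesis by simp
    qed
    then show "\<exists>N. \<forall>n\<in>B. N \<le> n \<longrightarrow> norm (M n n - l) < \<epsilon>" by blast
  qed
  then show thesis by (rule that)
qed

text \<open>
  If the columns are null along \<open>B\<close> but \<open>B\<close> is not tame, then finite blocks \<open>G\<^sub>0, G\<^sub>1, \<dots>\<close> with
  marked points \<open>n\<^sub>i \<in> G\<^sub>i\<close> are chosen one after the other such that consecutive values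
  \<open>sum (M n\<^sub>i) G\<^sub>i\<close> stay apart while row \<open>n\<^sub>i\<close> is negligible on all the other blocks.
\<close>

lemma killing_subset:
  assumes nt: "\<not> tame M B" and inf: "infinite B"
  obtains A where "A \<subseteq> B" "infinite A" "kills A M"
proof (cases "null_columns M B")
  case False
  then have "kills B M" by (simp add: kills_def)
  with inf that show thesis by blast
next
  case True
  then obtain \<epsilon> where e: "\<epsilon> > 0" and w: "\<And>N. \<exists>n n' G G'. admissible B N n G \<and> admissible B N n' G' \<and>
        \<epsilon> \<le> norm (sum (M n) G - sum (M n') G')"
    using nt unfolding tame_def by (metis not_le)
  \<comment> \<open>Of two block sums at distance \<open>\<epsilon>\<close>, one is at distance at
    least \<open>\<epsilon> / 2 = 8 * \<delta>\<close> from the preceding one. Passing from block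
    sums to full row sums costs \<open>2 * \<delta>\<close> in each of two rows, and the remaining
    \<open>4 * \<delta>\<close> contradicts two values closer than \<open>2 * \<delta>\<close> to a
    limit.\<close>
  define \<delta> where "\<delta> = \<epsilon> / 16"
  have d: "\<delta> > 0" using e by (simp add: \<delta>_def)
  \<comment> \<open>Earlier blocks lie below \<open>K\<close>, the new one between \<open>K\<close>
    and \<open>K'\<close>, later ones beyond \<open>K'\<close>. The new row is small on the first
    part by null columns and on the last part by summability.\<close>
  define next_ok where "next_ok n G K n' G' K' \<longleftrightarrow> admissible B K n' G' \<and> K < K' \<and> G' \<subseteq> {..<K'} \<and>
      8 * \<delta> \<le> norm (sum (M n') G' - sum (M n) G) \<and>
      (\<forall>A\<subseteq>{..<K}. norm (row_sum M A n') \<le> \<delta>) \<and> (\<forall>A\<subseteq>{K'..}. norm (row_sum M A n') \<le> \<delta>)"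
    for n G K n' G' K'
  have ex: "\<exists>n' G' K'. next_ok n G K n' G' K'" for n G K
  proof -
    obtain N where N: "\<And>n A. n \<in> B \<Longrightarrow> N \<le> n \<Longrightarrow> A \<subseteq> {..<K} \<Longrightarrow> norm (row_sum M A n) < \<delta>"
      using null_columns_head[OF True d] by blast
    obtain n1 n2 G1 G2 where g: "admissible B (max N K) n1 G1" "admissible B (max N K) n2 G2"
        "\<epsilon> \<le> norm (sum (M n1) G1 - sum (M n2) G2)"
      using w by blast
    have "8 * \<delta> \<le> norm (sum (M n1) G1 - sum (M n) G) \<or> 8 * \<delta> \<le> norm (sum (M n2) G2 - sum (M n) G)"
      using g(3) norm_triangle_ineq4[of "sum (M n1) G1 - sum (M n) G" "sum (M n2) G2 - sum (M n) G"]
      by (simp add: \<delta>_def) linarith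
    then obtain n' G' where n': "admissible B (max N K) n' G'" "8 * \<delta> \<le> norm (sum (M n') G' - sum (M n) G)"
      using g by blast
    obtain L where L: "\<And>A. A \<subseteq> {L..} \<Longrightarrow> norm (row_sum M A n') \<le> \<delta>"
      using small_tail[OF d] by blast
    obtain L' where L': "G' \<subseteq> {..<L'}"
      using n'(1) finite_nat_iff_bounded unfolding admissible_def by blast
    have "n' \<in> B" "N \<le> n'" using admissible_ge[OF n'(1)] by auto
    then have "\<forall>A\<subseteq>{..<K}. norm (row_sum M A n') \<le> \<delta>" using N less_imp_le by blast
    moreover have "{Max {L, L', Suc K}..} \<subseteq> {L..}" by auto
    then have "\<forall>A\<subseteq>{Max {L, L', Suc K}..}. norm (row_sum M A n') \<le> \<delta>"
      using L by (meson order.trans)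
    moreover have "G' \<subseteq> {..<Max {L, L', Suc K}}"
      using L' by (rule order.trans) auto
    moreover have "admissible B K n' G'" by (rule admissible_mono[OF n'(1)]) auto
    moreover have "K < Max {L, L', Suc K}" by auto
    ultimately have "next_ok n G K n' G' (Max {L, L', Suc K})"
      unfolding next_ok_def using n'(2) by blast
    then show ?thesis by blast
  qed
  define nxt where "nxt s = (SOME t. next_ok (fst s) (fst (snd s)) (snd (snd s)) (fst t) (fst (snd t)) (snd (snd t)))"
    for s :: "nat \<times> nat set \<times> nat"
  \<comment> \<open>The initial block \<open>{}\<close> is a dummy; the set \<open>A\<close> below
    is built from the blocks with index \<open>Suc i\<close>.\<close>
  define st where "st = rec_nat (0, {}, 0) (\<lambda>_. nxt)"
  define p G K where "p i = fst (st i)" and "G i = fst (snd (st i))" and "K i = snd (snd (st i))" for i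
  have step: "next_ok (p i) (G i) (K i) (p (Suc i)) (G (Suc i)) (K (Suc i))" for i
  proof -
    have "\<exists>t. next_ok (p i) (G i) (K i) (fst t) (fst (snd t)) (snd (snd t))"
      using ex[of "p i" "G i" "K i"] by auto
    from someI_ex[OF this] show ?thesis
      by (simp add: p_def G_def K_def st_def nxt_def)
  qed
  have K_mono: "i \<le> j \<Longrightarrow> K i \<le> K j" for i j
    by (rule lift_Suc_mono_le[of K]) (use step in \<open>auto simp: next_ok_def intro: less_imp_le\<close>)
  have K_ge: "i \<le> K i" for i
  proof (induction i)
    case (Suc i)
    then show ?case using step[of i] by (simp add: next_ok_def)
  qed simp
  have adm: "admissible B (K i) (p (Suc i)) (G (Suc i))" "G (Suc i) \<subseteq> {..<K (Suc i)}" for i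
    using step[of i] by (auto simp: next_ok_def)
  define A where "A = (\<Union>i. G (Suc i))"
  have pA: "p (Suc i) \<in> A" "i \<le> p (Suc i)" for i
    using adm(1)[of i] K_ge[of i] by (auto simp: A_def admissible_def)
  have "A \<subseteq> B" using adm(1) by (auto simp: A_def admissible_def)
  moreover have "infinite A"
    unfolding infinite_nat_iff_unbounded_le using pA by blast
  moreover have "kills A M"
  proof -
    have close: "norm (row_sum M A (p (Suc i)) - sum (M (p (Suc i))) (G (Suc i))) \<le> 2 * \<delta>" for i
    proof -
      have parts: "A = G (Suc i) \<union> (A \<inter> {..<K i} \<union> A \<inter> {K (Suc i)..})"
      proof
        show "A \<subseteq> G (Suc i) \<union> (A \<inter> {..<K i} \<union> A \<inter> {K (Suc i)..})"
        proof
          fix m assume m: "m \<in> A"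
          then obtain j where j: "m \<in> G (Suc j)" by (auto simp: A_def)
          then have "K j \<le> m" "m < K (Suc j)" using adm[of j] by (auto simp: admissible_def)
          moreover have "j < i \<Longrightarrow> K (Suc j) \<le> K i" "i < j \<Longrightarrow> K (Suc i) \<le> K j"
            by (simp_all add: K_mono)
          ultimately show "m \<in> G (Suc i) \<union> (A \<inter> {..<K i} \<union> A \<inter> {K (Suc i)..})"
            using m j by (cases i j rule: linorder_cases) auto
        qed
      qed (auto simp: A_def)
      have "K i \<le> K (Suc i)" by (rule K_mono) simp
      have disj: "G (Suc i) \<inter> (A \<inter> {..<K i} \<union> A \<inter> {K (Suc i)..}) = {}"
        "A \<inter> {..<K i} \<inter> (A \<inter> {K (Suc i)..}) = {}"
        using adm[of i] \<open>K i \<le> K (Suc i)\<close> by (auto simp: admissible_def)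
      have "row_sum M A (p (Suc i)) = row_sum M (G (Suc i)) (p (Suc i)) +
        (row_sum M (A \<inter> {..<K i}) (p (Suc i)) + row_sum M (A \<inter> {K (Suc i)..}) (p (Suc i)))"
        by (subst parts, subst row_sum_Un[OF disj(1)], subst row_sum_Un[OF disj(2)]) simp
      moreover have "finite (G (Suc i))" using adm(1) by (simp add: admissible_def)
      moreover have "norm (row_sum M (A \<inter> {..<K i}) (p (Suc i))) \<le> \<delta>"
        "norm (row_sum M (A \<inter> {K (Suc i)..}) (p (Suc i))) \<le> \<delta>"
        using step[of i] by (auto simp: next_ok_def)
      ultimately show ?thesis
        using norm_triangle_ineq[of "row_sum M (A \<inter> {..<K i}) (p (Suc i))" "row_sum M (A \<inter> {K (Suc i)..}) (p (Suc i))"]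
        by (simp add: row_sum_finite)
    qed
    have far: "4 * \<delta> \<le> norm (row_sum M A (p (Suc (Suc i))) - row_sum M A (p (Suc i)))" for i
    proof -
      let ?a = "row_sum M A (p (Suc i))" and ?b = "row_sum M A (p (Suc (Suc i)))"
      let ?c = "sum (M (p (Suc i))) (G (Suc i))" and ?d = "sum (M (p (Suc (Suc i)))) (G (Suc (Suc i)))"
      have "8 * \<delta> \<le> norm (?d - ?c)" using step[of "Suc i"] by (auto simp: next_ok_def)
      also have "?d - ?c = (?a - ?c) - (?b - ?d) + (?b - ?a)" by simp
      also have "norm \<dots> \<le> norm (?a - ?c) + norm (?b - ?d) + norm (?b - ?a)"
        by (meson add_right_mono norm_triangle_ineq norm_triangle_ineq4 order.trans)
      finally show ?thesis using close[of i] close[of "Suc i"] by linarith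
    qed
    have "\<not> (row_sum M A \<longlongrightarrow> l) (along A)" for l
    proof
      assume "(row_sum M A \<longlongrightarrow> l) (along A)"
      then obtain N where N: "\<And>n. n \<in> A \<Longrightarrow> N \<le> n \<Longrightarrow> norm (row_sum M A n - l) < 2 * \<delta>"
        unfolding tendsto_along_iff using d by (metis mult_pos_pos zero_less_numeral)
      have "norm (row_sum M A (p (Suc N)) - l) < 2 * \<delta>" "norm (row_sum M A (p (Suc (Suc N))) - l) < 2 * \<delta>"
        using pA[of N] pA[of "Suc N"] by (auto intro!: N)
      then show False
        using far[of N] norm_triangle_ineq4[of "row_sum M A (p (Suc (Suc N))) - l" "row_sum M A (p (Suc N)) - l"]
        by simp
    qed
    then show ?thesis by (auto simp: kills_def)
  qed
  ultimately show thesis by (rule that)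
qed

end

section \<open>The almost disjoint family\<close>

text \<open>
  Fewer than \<open>|UNIV|\<close> points are used before stage \<open>i\<close> of the recursion, and they meet fewer than
  \<open>|UNIV|\<close> of the pairwise disjoint pairs \<open>g i z\<close>.
\<close>

lemma separated_selection:
  includes cardinal_syntax
  fixes g :: "'i \<Rightarrow> 'i \<Rightarrow> 'a \<times> 'a"
  assumes inf: "infinite (UNIV :: 'i set)"
    and sep: "\<And>i z z'. z \<noteq> z' \<Longrightarrow> separated (g i z) (g i z')"
  obtains h where "\<And>i j. i \<noteq> j \<Longrightarrow> separated (g i (h i)) (g j (h j))"
proof -
  let ?r = "|UNIV :: 'i set|"
  have wo: "Well_order ?r" by (rule card_of_Well_order)
  have wf: "wf (?r - Id)" using wo by (auto simp: well_order_on_def)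
  have tot: "(i, j) \<in> ?r - Id \<or> (j, i) \<in> ?r - Id" if "i \<noteq> j" for i j
    using wo that by (auto simp: well_order_on_def linear_order_on_def total_on_def Field_card_of)
  define P where "P h i z \<longleftrightarrow> (\<forall>j. (j, i) \<in> ?r - Id \<longrightarrow> separated (g i z) (g j (h j)))" for h i z
  have "\<exists>h. \<forall>i. P h i (h i)"
  proof (rule dependent_wf_choice[OF wf])
    show "P f x r = P g x r" if "\<And>z. (z, x) \<in> ?r - Id \<Longrightarrow> f z = g z" for f g x r
      using that by (auto simp: P_def)
    show "\<exists>z. P h i z" for i h
    proof (rule ccontr)
      assume no: "\<nexists>z. P h i z"
      define U where "U = (\<lambda>j. fst (g j (h j))) ` underS ?r i \<union> (\<lambda>j. snd (g j (h j))) ` underS ?r i"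
      have "|underS ?r i| <o ?r"
        by (rule card_of_underS[OF card_of_Card_order]) (simp add: Field_card_of)
      then have "|U| <o ?r"
        unfolding U_def
        by (intro card_of_Un_ordLess_infinite inf ordLeq_ordLess_trans[OF card_of_image])
      moreover have "\<exists>c. c \<in> {fst (g i z), snd (g i z)} \<inter> U" for z
        using no by (force simp: P_def separated_def U_def underS_def)
      then obtain c where c: "\<And>z. c z \<in> {fst (g i z), snd (g i z)} \<inter> U" by metis
      have "inj c"
        using c sep[of _ _ i] unfolding inj_def separated_def by (metis Int_iff empty_iff)
      moreover have "range c \<subseteq> U" using c by blast
      ultimately show False
        using card_of_ordLeq[of "UNIV :: 'i set" U] not_ordLess_ordLeq by blast
    qed
  qed
  then obtain h where h: "\<And>i j. (j, i) \<in> ?r - Id \<Longrightarrow> separated (g i (h i)) (g j (h j))"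
    by (auto simp: P_def)
  show thesis
  proof
    fix i j :: 'i assume "i \<noteq> j"
    then show "separated (g i (h i)) (g j (h j))"
      using tot[of i j] h[of i j] h[of j i] by (auto simp: separated_def)
  qed
qed

lemma uncountable_nat_bool: "uncountable (UNIV :: (nat \<Rightarrow> bool) set)"
proof
  assume "countable (UNIV :: (nat \<Rightarrow> bool) set)"
  then obtain f :: "nat \<Rightarrow> nat \<Rightarrow> bool" where f: "range f = UNIV"
    using uncountable_def by blast
  then obtain n where "f n = (\<lambda>k. \<not> f k k)" by (metis UNIV_I imageE)
  then show False by (metis (full_types))
qed

text \<open>Countably many bit sequences are merged into one. The second component makes each matrix
  occur at continuum many stages, one for every value of that component.\<close>

lemma surj_matrices:
  fixes code :: "'k \<Rightarrow> nat \<Rightarrow> bool"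
  assumes "inj code"
  obtains e :: "(nat \<Rightarrow> bool) \<Rightarrow> (nat \<Rightarrow> nat \<Rightarrow> 'k) \<times> (nat \<Rightarrow> bool)" where "surj e"
proof -
  define enc where "enc p l = (case from_nat l of Inl (i, j, k) \<Rightarrow> code (fst p i j) k | Inr k \<Rightarrow> snd p k)"
    for p :: "(nat \<Rightarrow> nat \<Rightarrow> 'k) \<times> (nat \<Rightarrow> bool)" and l
  have "inj enc"
  proof (rule injI)
    fix p q assume eq: "enc p = enc q"
    have "fst p i j = fst q i j" for i j
    proof -
      have "code (fst p i j) k = code (fst q i j) k" for k
        using fun_cong[OF eq, of "to_nat (Inl (i, j, k) :: (nat \<times> nat \<times> nat) + nat)"] by (simp add: enc_def)
      then have "code (fst p i j) = code (fst q i j)" ..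
      then show ?thesis by (rule injD[OF assms])
    qed
    moreover have "snd p k = snd q k" for k
      using fun_cong[OF eq, of "to_nat (Inr k :: (nat \<times> nat \<times> nat) + nat)"] by (simp add: enc_def)
    ultimately show "p = q" by (simp add: prod_eq_iff fun_eq_iff)
  qed
  then show thesis using that inj_imp_surj_inv by blast
qed

section \<open>Wild matrices have many obstacles, the others are almost scalar\<close>

definition wild :: "(nat \<Rightarrow> nat \<Rightarrow> 'k::real_normed_vector) \<Rightarrow> bool" where
  "wild M \<longleftrightarrow> \<not> negligible_pairs {p. fst p \<noteq> snd p \<and> \<not> tame M (branches p)}"

text \<open>Non-tameness is a countable union over \<open>i\<close>, so one index already gives a
  set of pairs that is not negligible. For this index the condition is G-delta and the perfect set
  theorem applies.\<close>

lemma wild_imp_family: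
  assumes "wild M"
  shows "\<exists>q :: (nat \<Rightarrow> bool) \<Rightarrow> _. (\<forall>z. \<not> tame M (branches (q z))) \<and> (\<forall>z z'. z \<noteq> z' \<longrightarrow> separated (q z) (q z'))"
proof -
  have "{p. fst p \<noteq> snd p \<and> \<not> tame M (branches p)} =
      (\<Union>i. {p. fst p \<noteq> snd p \<and> (\<forall>N. wild_at M i N (branches p))})"
    by (auto simp: not_tame_iff)
  then obtain i where "\<not> negligible_pairs {p. fst p \<noteq> snd p \<and> (\<forall>N. wild_at M i N (branches p))}"
    using assms negligible_pairs_UN[of UNIV "\<lambda>i. {p. fst p \<noteq> snd p \<and> (\<forall>N. wild_at M i N (branches p))}"]
    by (auto simp: wild_def)
  then show ?thesis
  proof (rule perfect_family_of_pairs[of "wild_at M i", OF finitary_wild_at])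
    fix q :: "(nat \<Rightarrow> bool) \<Rightarrow> _"
    assume "\<And>z k. wild_at M i k (branches (q z))" "\<And>z z'. z \<noteq> z' \<Longrightarrow> separated (q z) (q z')"
    then show ?thesis unfolding not_tame_iff by blast
  qed
qed

lemma not_countable_avoid:
  assumes "countable C"
  shows "\<exists>x :: nat \<Rightarrow> bool. x \<notin> C \<and> x \<noteq> y"
proof -
  have "countable (insert y C)" using assms by simp
  then have "insert y C \<noteq> UNIV" using uncountable_nat_bool by metis
  then show ?thesis by blast
qed

text \<open>Such a matrix serves as a default at stages whose listed matrix is not wild or not
  summable. Here column 0 is constantly 1, hence null along no infinite set.\<close>

lemma ex_wild_matrix:
  "\<exists>M :: nat \<Rightarrow> nat \<Rightarrow> 'k::{real_normed_field, banach}. abs_summable_rows M \<and> wild M"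
proof (intro exI conjI)
  let ?M = "\<lambda>(n::nat) (m::nat). if m = 0 then 1 else 0 :: 'k"
  have "(\<lambda>m. norm (if m = 0 then 1 else 0 :: 'k)) summable_on {0}" by simp
  then have "(\<lambda>m. norm (if m = 0 then 1 else 0 :: 'k)) summable_on (UNIV :: nat set)"
    by (subst (asm) summable_on_cong_neutral[where T = UNIV]) auto
  then show "abs_summable_rows ?M" by (simp add: abs_summable_rows_def)
  have "\<not> tame ?M (branches p)" for p
  proof -
    have "infinite (branches p)" by (simp add: branches_def infinite_branch)
    then have bot: "along (branches p) \<noteq> bot" by (rule along_neq_bot)
    have "\<not> null_columns ?M (branches p)"
    proof
      assume "null_columns ?M (branches p)"
      then have "((\<lambda>n. ?M n 0) \<longlongrightarrow> 0) (along (branches p))"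
        unfolding null_columns_def by blast
      then have "((\<lambda>n. 1 :: 'k) \<longlongrightarrow> 0) (along (branches p))" by simp
      from tendsto_unique[OF bot tendsto_const this] show False by simp
    qed
    then show ?thesis by (simp add: tame_def)
  qed
  moreover have "\<not> negligible_pairs {p :: (nat \<Rightarrow> bool) \<times> (nat \<Rightarrow> bool). fst p \<noteq> snd p}"
  proof
    assume "negligible_pairs {p :: (nat \<Rightarrow> bool) \<times> (nat \<Rightarrow> bool). fst p \<noteq> snd p}"
    then obtain C :: "(nat \<Rightarrow> bool) set" where C: "countable C" "\<And>x y. x \<noteq> y \<Longrightarrow> x \<in> C \<or> y \<in> C"
      unfolding negligible_pairs_def by auto
    obtain x where x: "x \<notin> C" using not_countable_avoid[OF C(1)] by blast
    obtain y where "y \<notin> C" "y \<noteq> x" using not_countable_avoid[OF C(1)] by blast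
    with x C(2) show False by blast
  qed
  ultimately show "wild ?M" by (simp add: wild_def)
qed

text \<open>Outside \<open>C\<close> the union of any two branches is tame. Comparison with one
  fixed branch \<open>x0\<close> forces the same diagonal limit \<open>l\<close> on all branches,
  and tameness of the unions makes the row sums over part of one branch vanish along every other
  one.\<close>

lemma not_wild_imp_scalar:
  fixes M :: "nat \<Rightarrow> nat \<Rightarrow> 'k::banach"
  assumes M: "abs_summable_rows M" and nw: "\<not> wild M"
  obtains C l where "countable C"
    "\<And>p q A B. {fst p, snd p, fst q, snd q} \<inter> C = {} \<Longrightarrow> A \<subseteq> branches p \<Longrightarrow> B \<subseteq> branches q \<Longrightarrow>
       null_columns M A \<and> ((\<lambda>n. row_sum M A n - (if n \<in> A then l else 0)) \<longlongrightarrow> 0) (along B)"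
proof -
  obtain C where C: "countable C" "\<And>x y. x \<noteq> y \<Longrightarrow> x \<notin> C \<Longrightarrow> y \<notin> C \<Longrightarrow> tame M (branch x \<union> branch y)"
    using nw unfolding wild_def negligible_pairs_def by (auto simp: branches_def)
  have tame: "tame M (branch x \<union> branch y)" if "x \<notin> C" "y \<notin> C" for x y
  proof (cases "x = y")
    case True
    obtain z where "z \<notin> C" "z \<noteq> x" using not_countable_avoid[OF C(1)] by blast
    then show ?thesis using C(2)[of x z] that True tame_mono by blast
  qed (use C(2) that in blast)
  obtain x0 where x0: "x0 \<notin> C" using not_countable_avoid[OF C(1)] by blast
  have "tame M (branch x0)" using tame[OF x0 x0] by simp
  then obtain l where l: "((\<lambda>n. M n n) \<longlongrightarrow> l) (along (branch x0))"
    using tame_diagonal[OF M] infinite_branch by blast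
  have diag: "((\<lambda>n. M n n) \<longlongrightarrow> l) (along (branch x))" if x: "x \<notin> C" for x
  proof -
    obtain l' where l': "((\<lambda>n. M n n) \<longlongrightarrow> l') (along (branch x0 \<union> branch x))"
      using tame_diagonal[OF M tame[OF x0 x]] infinite_branch by blast
    then have "((\<lambda>n. M n n) \<longlongrightarrow> l') (along (branch x0))" "((\<lambda>n. M n n) \<longlongrightarrow> l') (along (branch x))"
      by (auto intro: tendsto_mono[OF along_mono])
    then show ?thesis
      using l tendsto_unique[OF along_neq_bot[OF infinite_branch]] by blast
  qed
  have off: "((\<lambda>n. row_sum M A n - (if n \<in> A then l else 0)) \<longlongrightarrow> 0) (along (branch z))"
    if xy: "x \<notin> C" "y \<notin> C" "z \<notin> C" and A: "A \<subseteq> branch x \<union> branch y" for x y z A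
  proof -
    \<comment> \<open>Together with \<open>branch z\<close> up to three branches are involved, while
      tameness is known for two; so \<open>A\<close> is cut into disjoint pieces that lie in one
      branch each.\<close>
    let ?D = "A \<inter> branch x" and ?E = "A \<inter> branch y - branch x"
    have "((\<lambda>n. row_sum M (?D - {n}) n) \<longlongrightarrow> 0) (along (branch x \<union> branch z))"
      "((\<lambda>n. row_sum M (?E - {n}) n) \<longlongrightarrow> 0) (along (branch y \<union> branch z))"
      by (rule tame_off_diagonal[OF M tame]; use xy in auto)+
    then have "((\<lambda>n. row_sum M (?D - {n}) n) \<longlongrightarrow> 0) (along (branch z))"
      "((\<lambda>n. row_sum M (?E - {n}) n) \<longlongrightarrow> 0) (along (branch z))"
      by (auto intro: tendsto_mono[OF along_mono])
    moreover have "((\<lambda>n. if n \<in> A then M n n - l else 0) \<longlongrightarrow> 0) (along (branch z))"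
    proof (rule tendsto_norm_zero_cancel, rule tendsto_sandwich[OF _ _ tendsto_const])
      show "((\<lambda>n. norm (M n n - l)) \<longlongrightarrow> 0) (along (branch z))"
        using diag[OF xy(3)] tendsto_norm_zero LIM_zero by blast
    qed auto
    ultimately have "((\<lambda>n. row_sum M (?D - {n}) n + row_sum M (?E - {n}) n + (if n \<in> A then M n n - l else 0)) \<longlongrightarrow> 0 + 0 + 0) (along (branch z))"
      by (intro tendsto_add)
    moreover have "row_sum M (?D - {n}) n + row_sum M (?E - {n}) n + (if n \<in> A then M n n - l else 0)
       = row_sum M A n - (if n \<in> A then l else 0)" for n
    proof -
      have "row_sum M A n = row_sum M ((?D - {n}) \<union> ((?E - {n}) \<union> (A \<inter> {n}))) n"
        by (rule arg_cong[of _ _ "\<lambda>A. row_sum M A n"]) (use A in auto)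
      also have "\<dots> = row_sum M (?D - {n}) n + (row_sum M (?E - {n}) n + row_sum M (A \<inter> {n}) n)"
        by (subst row_sum_Un[OF M], force, subst row_sum_Un[OF M], force, rule refl)
      also have "row_sum M (A \<inter> {n}) n = (if n \<in> A then M n n else 0)"
        by (simp add: row_sum_finite[OF M])
      finally show ?thesis by simp
    qed
    ultimately show ?thesis by simp
  qed
  show thesis
  proof (rule that[OF C(1), of l])
    fix p q A B assume pq: "{fst p, snd p, fst q, snd q} \<inter> C = {}"
      and A: "A \<subseteq> branches p" and B: "B \<subseteq> branches q"
    have "null_columns M (branches p)"
      using tame[of "fst p" "snd p"] pq by (simp add: tame_def branches_def)
    then have "null_columns M A" using A null_columns_mono by blast
    moreover have "((\<lambda>n. row_sum M A n - (if n \<in> A then l else 0)) \<longlongrightarrow> 0) (along (branches q))"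
      unfolding branches_def along_Un
      by (intro filterlim_sup off[of "fst p" "snd p"]) (use pq A in \<open>auto simp: branches_def\<close>)
    then have "((\<lambda>n. row_sum M A n - (if n \<in> A then l else 0)) \<longlongrightarrow> 0) (along B)"
      using tendsto_mono[OF along_mono[OF B]] by blast
    ultimately show "null_columns M A \<and> ((\<lambda>n. row_sum M A n - (if n \<in> A then l else 0)) \<longlongrightarrow> 0) (along B)" ..
  qed
qed

text \<open>What the operator theory needs of \<open>\<A>\<close> besides almost disjointness and
  infinite members: a matrix is excluded as the matrix of an operator or is scalar off a countable
  subfamily. The \<open>itself\<close> argument fixes the scalar field, which otherwise occurs only
  under the quantifier over \<open>M\<close>.\<close>

definition matrix_rigid :: "'k::real_normed_field itself \<Rightarrow> nat set set \<Rightarrow> bool" where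
  "matrix_rigid _ \<A> \<longleftrightarrow> (\<forall>M :: nat \<Rightarrow> nat \<Rightarrow> 'k. abs_summable_rows M \<longrightarrow>
     uncountable {A \<in> \<A>. kills A M} \<or>
     (\<exists>l \<C>. countable \<C> \<and> (\<forall>A\<in>\<A> - \<C>. null_columns M A \<and>
        (\<forall>B\<in>\<A> - \<C>. (row_sum M A \<longlongrightarrow> (if A = B then l else 0)) (along B)))))"

theorem ex_matrix_rigid:
  fixes code :: "'k::{real_normed_field, banach} \<Rightarrow> nat \<Rightarrow> bool"
  assumes "inj code"
  obtains \<A> where "uncountable \<A>" "\<And>A. A \<in> \<A> \<Longrightarrow> infinite A" "almost_disjoint \<A>"
    "matrix_rigid TYPE('k) \<A>"
proof -
  obtain e :: "(nat \<Rightarrow> bool) \<Rightarrow> (nat \<Rightarrow> nat \<Rightarrow> 'k) \<times> (nat \<Rightarrow> bool)" where e: "surj e"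
    using surj_matrices[OF assms] .
  obtain M0 :: "nat \<Rightarrow> nat \<Rightarrow> 'k" where M0: "abs_summable_rows M0" "wild M0"
    using ex_wild_matrix by blast
  define mat where "mat c = (let M = fst (e c) in if abs_summable_rows M \<and> wild M then M else M0)" for c
  have mat: "abs_summable_rows (mat c)" "wild (mat c)" for c
    using M0 by (auto simp: mat_def Let_def)
  have "\<exists>q :: (nat \<Rightarrow> bool) \<Rightarrow> _. (\<forall>z. \<not> tame (mat c) (branches (q z))) \<and> (\<forall>z z'. z \<noteq> z' \<longrightarrow> separated (q z) (q z'))" for c
    by (rule wild_imp_family[OF mat(2)])
  then obtain g :: "(nat \<Rightarrow> bool) \<Rightarrow> (nat \<Rightarrow> bool) \<Rightarrow> _" where
    g: "\<And>c z. \<not> tame (mat c) (branches (g c z))" "\<And>c z z'. z \<noteq> z' \<Longrightarrow> separated (g c z) (g c z')"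
    by metis
  have "infinite (UNIV :: (nat \<Rightarrow> bool) set)"
    using uncountable_nat_bool uncountable_infinite by blast
  then obtain h where h: "\<And>c d. c \<noteq> d \<Longrightarrow> separated (g c (h c)) (g d (h d))"
    using separated_selection[of g] g(2) by blast
  define p where "p c = g c (h c)" for c
  have "\<exists>A. A \<subseteq> branches (p c) \<and> infinite A \<and> kills A (mat c)" for c
  proof -
    have "infinite (branches (g c (h c)))" by (simp add: branches_def infinite_branch)
    from killing_subset[OF mat(1) g(1) this] show ?thesis unfolding p_def by blast
  qed
  then obtain A where A: "\<And>c. A c \<subseteq> branches (p c)" "\<And>c. infinite (A c)" "\<And>c. kills (A c) (mat c)"
    by metis
  have disj: "finite (A c \<inter> A d)" if "c \<noteq> d" for c d
    using finite_branches_Int[OF h[OF that]] A(1)[of c] A(1)[of d]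
    by (metis Int_mono finite_subset p_def)
  have inj: "inj A"
    by (rule injI) (metis A(2) disj inf.idem)
  show thesis
  proof
    show "uncountable (range A)"
      using uncountable_nat_bool countable_image_inj_on[OF _ inj] by blast
    show "infinite B" if "B \<in> range A" for B using that A(2) by blast
    show "almost_disjoint (range A)"
      unfolding almost_disjoint_def pairwise_def by (auto intro!: disj)
    show "matrix_rigid TYPE('k) (range A)"
      unfolding matrix_rigid_def
    proof (intro allI impI)
      fix M :: "nat \<Rightarrow> nat \<Rightarrow> 'k" assume M: "abs_summable_rows M"
      show "uncountable {B \<in> range A. kills B M} \<or>
         (\<exists>l \<C>. countable \<C> \<and> (\<forall>B\<in>range A - \<C>. null_columns M B \<and>
        (\<forall>B'\<in>range A - \<C>. (row_sum M B \<longlongrightarrow> (if B = B' then l else 0)) (along B'))))"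
      proof (cases "wild M")
        case True
        define I where "I = {c. fst (e c) = M}"
        have "UNIV \<subseteq> (snd \<circ> e) ` I"
        proof
          fix z
          obtain c where "e c = (M, z)" using e by (metis surjD)
          then show "z \<in> (snd \<circ> e) ` I" by (intro image_eqI[of _ _ c]) (auto simp: I_def)
        qed
        then have "uncountable I"
          using uncountable_nat_bool by (meson countable_image countable_subset)
        moreover have "A ` I \<subseteq> {B \<in> range A. kills B M}"
        proof
          fix B assume "B \<in> A ` I"
          then obtain c where "B = A c" "mat c = M" using True M by (auto simp: I_def mat_def)
          then show "B \<in> {B \<in> range A. kills B M}" using A(3)[of c] by auto
        qed
        ultimately have "uncountable {B \<in> range A. kills B M}"
          using countable_image_inj_on[OF countable_subset inj_on_subset[OF inj], of I] by blast
        then show ?thesis ..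
      next
        case False
        obtain C l where C: "countable C"
          "\<And>p q A B. {fst p, snd p, fst q, snd q} \<inter> C = {} \<Longrightarrow> A \<subseteq> branches p \<Longrightarrow> B \<subseteq> branches q \<Longrightarrow>
             null_columns M A \<and> ((\<lambda>n. row_sum M A n - (if n \<in> A then l else 0)) \<longlongrightarrow> 0) (along B)"
          by (rule not_wild_imp_scalar[OF M False]) (rule that, assumption, blast)
        \<comment> \<open>The pairs \<open>p c\<close> are pairwise separated, so each point of
          \<open>C\<close> belongs to at most one of them and \<open>J\<close> is countable.\<close>
        define J where "J = {c. fst (p c) \<in> C \<or> snd (p c) \<in> C}"
        have J: "countable J"
        proof -
          have "J = (\<Union>x\<in>C. {c. x \<in> {fst (p c), snd (p c)}})" by (auto simp: J_def)
          moreover have "countable {c. x \<in> {fst (p c), snd (p c)}}" for x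
          proof -
            have eq: "c = d" if "x \<in> {fst (p c), snd (p c)}" "x \<in> {fst (p d), snd (p d)}" for c d
              using h[of c d] that unfolding separated_def p_def by blast
            show ?thesis
            proof (cases "{c. x \<in> {fst (p c), snd (p c)}} = {}")
              case False
              then obtain d where "d \<in> {c. x \<in> {fst (p c), snd (p c)}}" by blast
              then have "{c. x \<in> {fst (p c), snd (p c)}} \<subseteq> {d}" using eq[of _ d] by blast
              then show ?thesis by (rule countable_subset) simp
            qed simp
          qed
          ultimately show ?thesis using C(1) by simp
        qed
        have good: "null_columns M (A c) \<and> (row_sum M (A c) \<longlongrightarrow> (if A c = A d then l else 0)) (along (A d))"
          if "c \<notin> J" "d \<notin> J" for c d
        proof -
          have lim: "null_columns M (A c)"
            "((\<lambda>n. row_sum M (A c) n - (if n \<in> A c then l else 0)) \<longlongrightarrow> 0) (along (A d))"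
            using C(2)[of "p c" "p d" "A c" "A d"] that A(1) by (auto simp: J_def)
          have "eventually (\<lambda>n. (if n \<in> A c then l else 0) = (if A c = A d then l else 0)) (along (A d))"
          proof (cases "c = d")
            case True
            then show ?thesis unfolding eventually_along by auto
          next
            case False
            then have "A c \<noteq> A d" using inj by (auto dest: injD)
            from eventually_along_notin[OF disj[OF False]] show ?thesis
              by eventually_elim (simp add: \<open>A c \<noteq> A d\<close>)
          qed
          then have "((\<lambda>n. if n \<in> A c then l else 0) \<longlongrightarrow> (if A c = A d then l else 0)) (along (A d))"
            by (rule tendsto_eventually)
          from tendsto_add[OF lim(2) this] show ?thesis using lim(1) by simp
        qed
        show ?thesis
        proof (intro disjI2 exI[of _ l] exI[of _ "A ` J"] conjI ballI)
          show "countable (A ` J)" using J by simp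
        next
          fix B assume "B \<in> range A - A ` J"
          then obtain c where c: "B = A c" "c \<notin> J" by blast
          then show "null_columns M B" using good by blast
          fix B' assume "B' \<in> range A - A ` J"
          then obtain d where d: "B' = A d" "d \<notin> J" by blast
          show "(row_sum M B \<longlongrightarrow> (if B = B' then l else 0)) (along B')"
            using good[OF c(2) d(2)] c(1) d(1) by simp
        qed
      qed
    qed
  qed
qed

section \<open>The space \<open>C\<^sub>0(K\<^sub>\<A>)\<close>\<close>

abbreviation (input) psi_C0 :: "nat set set \<Rightarrow> (nat + nat set \<Rightarrow> 'k::real_normed_field) set" where
  "psi_C0 \<A> \<equiv> C0_space (psi_space \<A>)"

text \<open>This is the one-point compactification of the discrete set \<open>A\<close>: a member of
  the cover that contains \<open>Inr A\<close> leaves out only finitely many points.\<close>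

lemma compactin_psi_nbhd:
  assumes "A \<in> \<A>"
  shows "compactin (psi_space \<A>) (psi_nbhd A {})"
  unfolding compactin_def
proof (intro conjI allI impI)
  show "psi_nbhd A {} \<subseteq> topspace (psi_space \<A>)"
    using assms by (auto simp: topspace_psi_space psi_nbhd_def)
  fix \<U> assume U: "Ball \<U> (openin (psi_space \<A>)) \<and> psi_nbhd A {} \<subseteq> \<Union>\<U>"
  then obtain V where V: "V \<in> \<U>" "Inr A \<in> V" by (auto simp: psi_nbhd_def)
  then obtain F where F: "finite F" "psi_nbhd A F \<subseteq> V"
    using U unfolding openin_psi_space psi_open_def by meson
  have "Inl ` (A \<inter> F) \<subseteq> \<Union>\<U>" using U by (auto simp: psi_nbhd_def)
  then have "\<exists>\<F>. finite \<F> \<and> \<F> \<subseteq> \<U> \<and> Inl ` (A \<inter> F) \<subseteq> \<Union>\<F>"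
    using F(1) finite_subset_Union[of "Inl ` (A \<inter> F)" \<U>] by (metis finite_Int finite_imageI)
  then obtain \<F> where "finite \<F>" "\<F> \<subseteq> \<U>" "Inl ` (A \<inter> F) \<subseteq> \<Union>\<F>" by blast
  then have "finite (insert V \<F>) \<and> insert V \<F> \<subseteq> \<U> \<and> psi_nbhd A {} \<subseteq> \<Union>(insert V \<F>)"
    using V(1) F(2) unfolding psi_nbhd_def by blast
  then show "\<exists>\<F>. finite \<F> \<and> \<F> \<subseteq> \<U> \<and> psi_nbhd A {} \<subseteq> \<Union>\<F>" by blast
qed

text \<open>Compact sets are the closed sets covered by finitely many isolated points and finitely
  many sets \<open>psi_nbhd A {}\<close>. In the cover used below the point \<open>Inr A\<close>
  lies in its own set only, so a finite subcover names every \<open>A\<close> with a large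
  value.\<close>

lemma psi_C0_iff:
  fixes f :: "nat + nat set \<Rightarrow> 'k::real_normed_field"
  shows "f \<in> psi_C0 \<A> \<longleftrightarrow>
    (\<forall>A. A \<notin> \<A> \<longrightarrow> f (Inr A) = 0) \<and>
    (\<forall>A\<in>\<A>. ((\<lambda>n. f (Inl n)) \<longlongrightarrow> f (Inr A)) (along A)) \<and>
    (\<forall>\<epsilon>>0. \<exists>\<F> F. finite \<F> \<and> \<F> \<subseteq> \<A> \<and> finite F \<and>
       (\<forall>n. \<epsilon> \<le> norm (f (Inl n)) \<longrightarrow> n \<in> F \<union> \<Union>\<F>) \<and> (\<forall>A\<in>\<A>. \<epsilon> \<le> norm (f (Inr A)) \<longrightarrow> A \<in> \<F>))"
    (is "_ \<longleftrightarrow> ?zero \<and> ?lim \<and> ?small")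
proof
  assume "f \<in> psi_C0 \<A>"
  then have cont: "continuous_map (psi_space \<A>) euclidean f"
    and comp: "\<And>\<epsilon>. \<epsilon> > 0 \<Longrightarrow> compactin (psi_space \<A>) {x \<in> topspace (psi_space \<A>). \<epsilon> \<le> norm (f x)}"
    and zero: "\<And>x. x \<notin> topspace (psi_space \<A>) \<Longrightarrow> f x = 0"
    by (auto simp: C0_space_def)
  have ?zero using zero by (auto simp: topspace_psi_space)
  moreover have ?lim
    unfolding tendsto_along_iff
  proof (intro ballI allI impI)
    fix A and \<epsilon> :: real assume A: "A \<in> \<A>" and e: "\<epsilon> > 0"
    have "openin (psi_space \<A>) {x \<in> topspace (psi_space \<A>). f x \<in> ball (f (Inr A)) \<epsilon>}"
      by (rule openin_continuous_map_preimage[OF cont]) (simp only: open_openin[symmetric] open_ball)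
    moreover have "Inr A \<in> {x \<in> topspace (psi_space \<A>). f x \<in> ball (f (Inr A)) \<epsilon>}"
      using A e by (auto simp: topspace_psi_space)
    ultimately obtain F where F: "finite F" "psi_nbhd A F \<subseteq> {x \<in> topspace (psi_space \<A>). f x \<in> ball (f (Inr A)) \<epsilon>}"
      unfolding openin_psi_space psi_open_def by blast
    obtain N where "F \<subseteq> {..<N}" using F(1) finite_nat_iff_bounded by blast
    then have "\<forall>n\<in>A. N \<le> n \<longrightarrow> Inl n \<in> psi_nbhd A F"
      by (auto simp: psi_nbhd_def)
    with F(2) have "\<forall>n\<in>A. N \<le> n \<longrightarrow> dist (f (Inr A)) (f (Inl n)) < \<epsilon>" by auto
    then show "\<exists>N. \<forall>n\<in>A. N \<le> n \<longrightarrow> norm (f (Inl n) - f (Inr A)) < \<epsilon>"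
      by (auto simp: dist_norm norm_minus_commute)
  qed
  moreover have ?small
  proof (intro allI impI)
    fix \<epsilon> :: real assume e: "\<epsilon> > 0"
    let ?K = "{x \<in> topspace (psi_space \<A>). \<epsilon> \<le> norm (f x)}"
    define g where "g = case_sum (\<lambda>n. {Inl n}) (\<lambda>A. psi_nbhd A {})"
    have g: "openin (psi_space \<A>) (g x)" "x \<in> g x" if "x \<in> topspace (psi_space \<A>)" for x
      using that openin_psi_space_isolated openin_psi_nbhd[of _ \<A> "{}"]
      by (auto simp: topspace_psi_space g_def psi_nbhd_def[of _ "{}"])
    have "?K \<subseteq> \<Union>(g ` topspace (psi_space \<A>))" using g(2) by blast
    moreover have "\<forall>U\<in>g ` topspace (psi_space \<A>). openin (psi_space \<A>) U" using g(1) by blast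
    ultimately obtain \<U> where U: "finite \<U>" "\<U> \<subseteq> g ` topspace (psi_space \<A>)" "?K \<subseteq> \<Union>\<U>"
      using comp[OF e] unfolding compactin_def by meson
    obtain C where C: "C \<subseteq> topspace (psi_space \<A>)" "finite C" "\<U> = g ` C"
      using finite_subset_image[OF U(1,2)] by blast
    have "finite {A. Inr A \<in> C}" "finite {n. Inl n \<in> C}"
      using finite_vimageI[OF C(2), of Inr] finite_vimageI[OF C(2), of Inl] by (auto simp: vimage_def)
    moreover have "{A. Inr A \<in> C} \<subseteq> \<A>" using C(1) by (auto simp: topspace_psi_space)
    moreover have cov: "\<exists>y\<in>C. x \<in> g y" if "x \<in> topspace (psi_space \<A>)" "\<epsilon> \<le> norm (f x)" for x
      using U(3) that C(3) by blast
    have "n \<in> {n. Inl n \<in> C} \<union> \<Union>{A. Inr A \<in> C}" if n: "\<epsilon> \<le> norm (f (Inl n))" for n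
    proof -
      obtain y where "y \<in> C" "Inl n \<in> g y" using cov[of "Inl n"] n by (auto simp: topspace_psi_space)
      then show ?thesis by (cases y) (auto simp: g_def psi_nbhd_def)
    qed
    moreover have "A \<in> {A. Inr A \<in> C}" if A: "A \<in> \<A>" "\<epsilon> \<le> norm (f (Inr A))" for A
    proof -
      obtain y where "y \<in> C" "Inr A \<in> g y" using cov[of "Inr A"] A by (auto simp: topspace_psi_space)
      then show ?thesis by (cases y) (auto simp: g_def psi_nbhd_def)
    qed
    ultimately show "\<exists>\<F> F. finite \<F> \<and> \<F> \<subseteq> \<A> \<and> finite F \<and>
       (\<forall>n. \<epsilon> \<le> norm (f (Inl n)) \<longrightarrow> n \<in> F \<union> \<Union>\<F>) \<and> (\<forall>A\<in>\<A>. \<epsilon> \<le> norm (f (Inr A)) \<longrightarrow> A \<in> \<F>)"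
      by (intro exI[of _ "{A. Inr A \<in> C}"] exI[of _ "{n. Inl n \<in> C}"]) blast
  qed
  ultimately show "?zero \<and> ?lim \<and> ?small" by blast
next
  assume *: "?zero \<and> ?lim \<and> ?small"
  have cont: "continuous_map (psi_space \<A>) euclidean f"
    unfolding continuous_map
  proof (intro conjI allI impI)
    fix U :: "'k set" assume "openin euclidean U"
    then have U: "open U" by simp
    show "openin (psi_space \<A>) {x \<in> topspace (psi_space \<A>). f x \<in> U}"
      unfolding openin_psi_space psi_open_def
    proof (intro conjI allI impI)
      show "{x \<in> topspace (psi_space \<A>). f x \<in> U} \<subseteq> range Inl \<union> Inr ` \<A>"
        by (auto simp: topspace_psi_space)
      fix A assume A: "Inr A \<in> {x \<in> topspace (psi_space \<A>). f x \<in> U}"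
      then have "A \<in> \<A>" by (auto simp: topspace_psi_space)
      then have "eventually (\<lambda>n. f (Inl n) \<in> U) (along A)"
        using * A U by (auto intro: topological_tendstoD)
      then obtain N where "\<forall>n\<in>A. N \<le> n \<longrightarrow> f (Inl n) \<in> U"
        unfolding eventually_along by blast
      then have "psi_nbhd A {..<N} \<subseteq> {x \<in> topspace (psi_space \<A>). f x \<in> U}"
        using A by (auto simp: psi_nbhd_def topspace_psi_space)
      then show "\<exists>F. finite F \<and> psi_nbhd A F \<subseteq> {x \<in> topspace (psi_space \<A>). f x \<in> U}" by blast
    qed
  qed auto
  have "compactin (psi_space \<A>) {x \<in> topspace (psi_space \<A>). \<epsilon> \<le> norm (f x)}" if e: "\<epsilon> > 0" for \<epsilon>
  proof -
    obtain \<F> F where F: "finite \<F>" "\<F> \<subseteq> \<A>" "finite F"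
       "\<forall>n. \<epsilon> \<le> norm (f (Inl n)) \<longrightarrow> n \<in> F \<union> \<Union>\<F>" "\<forall>A\<in>\<A>. \<epsilon> \<le> norm (f (Inr A)) \<longrightarrow> A \<in> \<F>"
      using * e by meson
    have "compactin (psi_space \<A>) (Inl ` F \<union> (\<Union>A\<in>\<F>. psi_nbhd A {}))"
    proof (rule compactin_Un)
      show "compactin (psi_space \<A>) (Inl ` F)"
        using F(3) by (intro finite_imp_compactin) (auto simp: topspace_psi_space)
      show "compactin (psi_space \<A>) (\<Union>A\<in>\<F>. psi_nbhd A {})"
        using F(1,2) compactin_psi_nbhd by (intro compactin_Union) auto
    qed
    moreover have "{x \<in> topspace (psi_space \<A>). \<epsilon> \<le> norm (f x)} \<subseteq> Inl ` F \<union> (\<Union>A\<in>\<F>. psi_nbhd A {})"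
      using F(4,5) by (fastforce simp: topspace_psi_space psi_nbhd_def)
    moreover have "closedin (psi_space \<A>) {x \<in> topspace (psi_space \<A>). f x \<in> {y. \<epsilon> \<le> norm y}}"
      using cont by (rule closedin_continuous_map_preimage)
        (simp, intro closed_Collect_le continuous_intros)
    ultimately show ?thesis using closed_compactin by auto
  qed
  moreover have "f x = 0" if "x \<notin> topspace (psi_space \<A>)" for x
    using that * by (cases x) (auto simp: topspace_psi_space)
  ultimately show "f \<in> psi_C0 \<A>" using cont by (simp add: C0_space_def)
qed

lemma psi_C0_I:
  fixes f :: "nat + nat set \<Rightarrow> 'k::real_normed_field"
  assumes "\<And>A. A \<notin> \<A> \<Longrightarrow> f (Inr A) = 0"
    and "\<And>A. A \<in> \<A> \<Longrightarrow> ((\<lambda>n. f (Inl n)) \<longlongrightarrow> f (Inr A)) (along A)"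
    and "\<And>\<epsilon>. \<epsilon> > 0 \<Longrightarrow> \<exists>\<F> F. finite \<F> \<and> \<F> \<subseteq> \<A> \<and> finite F \<and>
       (\<forall>n. \<epsilon> \<le> norm (f (Inl n)) \<longrightarrow> n \<in> F \<union> \<Union>\<F>) \<and> (\<forall>A\<in>\<A>. \<epsilon> \<le> norm (f (Inr A)) \<longrightarrow> A \<in> \<F>)"
  shows "f \<in> psi_C0 \<A>"
  using assms unfolding psi_C0_iff by blast

lemma psi_C0_zero: "f \<in> psi_C0 \<A> \<Longrightarrow> A \<notin> \<A> \<Longrightarrow> f (Inr A) = 0"
  unfolding psi_C0_iff by blast

lemma psi_C0_tendsto: "f \<in> psi_C0 \<A> \<Longrightarrow> A \<in> \<A> \<Longrightarrow> ((\<lambda>n. f (Inl n)) \<longlongrightarrow> f (Inr A)) (along A)"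
  unfolding psi_C0_iff by blast

lemma psi_C0_small:
  assumes f: "f \<in> psi_C0 \<A>" and e: "\<epsilon> > 0"
  shows "\<exists>\<F> F. finite \<F> \<and> \<F> \<subseteq> \<A> \<and> finite F \<and>
    (\<forall>n. n \<notin> F \<longrightarrow> n \<notin> \<Union>\<F> \<longrightarrow> norm (f (Inl n)) < \<epsilon>) \<and> (\<forall>A. A \<notin> \<F> \<longrightarrow> norm (f (Inr A)) < \<epsilon>)"
proof -
  obtain \<F> F where F: "finite \<F>" "\<F> \<subseteq> \<A>" "finite F"
    "\<forall>n. \<epsilon> \<le> norm (f (Inl n)) \<longrightarrow> n \<in> F \<union> \<Union>\<F>" "\<forall>A\<in>\<A>. \<epsilon> \<le> norm (f (Inr A)) \<longrightarrow> A \<in> \<F>"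
    using assms unfolding psi_C0_iff by meson
  have "norm (f (Inr A)) < \<epsilon>" if "A \<notin> \<F>" for A
    using F(5) that psi_C0_zero[OF f, of A] e by (cases "A \<in> \<A>") (auto simp: not_le[symmetric])
  moreover have "norm (f (Inl n)) < \<epsilon>" if "n \<notin> F" "n \<notin> \<Union>\<F>" for n
  proof (rule ccontr)
    assume "\<not> norm (f (Inl n)) < \<epsilon>"
    then have "n \<in> F \<union> \<Union>\<F>" using F(4) not_less by blast
    with that show False by blast
  qed
  ultimately show ?thesis using F(1-3) by (intro exI[of _ \<F>] exI[of _ F]) simp
qed

lemma psi_C0_bdd_above:
  fixes f :: "nat + nat set \<Rightarrow> 'k::real_normed_field"
  assumes f: "f \<in> psi_C0 \<A>"
  shows "bdd_above (range (\<lambda>x. norm (f x)))"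
proof -
  let ?K = "{x \<in> topspace (psi_space \<A>). 1 \<le> norm (f x)}"
  have "compactin (psi_space \<A>) ?K" "continuous_map (psi_space \<A>) euclidean f"
    using f by (auto simp: C0_space_def)
  then have "compact (f ` ?K)" using image_compactin compactin_euclidean_iff by blast
  then have "bounded (f ` ?K)" by (rule compact_imp_bounded)
  then obtain b where "\<forall>y\<in>f ` ?K. norm y \<le> b" unfolding bounded_iff ..
  then have b: "norm (f x) \<le> b" if "x \<in> ?K" for x using that by blast
  have "norm (f x) \<le> max b 1" for x
  proof (cases "x \<in> ?K")
    case False
    then have "norm (f x) \<le> 1"
      using f by (cases "x \<in> topspace (psi_space \<A>)") (auto simp: C0_space_def)
    then show ?thesis by simp
  qed (use b in \<open>simp add: max.coboundedI1\<close>)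
  then show ?thesis by (auto simp: bdd_above_def)
qed

lemma norm_le_sup_norm: "bdd_above (range (\<lambda>x. norm (f x))) \<Longrightarrow> norm (f x) \<le> sup_norm f"
  unfolding sup_norm_def by (rule cSUP_upper) auto

lemma sup_norm_le: "(\<And>x. norm (f x) \<le> c) \<Longrightarrow> sup_norm f \<le> c"
  unfolding sup_norm_def by (rule cSUP_least) auto

lemma psi_C0_norm_le: "f \<in> psi_C0 \<A> \<Longrightarrow> norm (f x) \<le> sup_norm f"
  by (rule norm_le_sup_norm[OF psi_C0_bdd_above])

lemma psi_C0_add:
  assumes f: "f \<in> psi_C0 \<A>" and g: "g \<in> psi_C0 \<A>"
  shows "(\<lambda>x. f x + g x) \<in> psi_C0 \<A>"
proof (rule psi_C0_I)
  fix \<epsilon> :: real assume e: "\<epsilon> > 0"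
  obtain \<F> F where F: "finite \<F>" "\<F> \<subseteq> \<A>" "finite F"
    "\<forall>n. n \<notin> F \<longrightarrow> n \<notin> \<Union>\<F> \<longrightarrow> norm (f (Inl n)) < \<epsilon> / 2" "\<forall>A. A \<notin> \<F> \<longrightarrow> norm (f (Inr A)) < \<epsilon> / 2"
    using psi_C0_small[OF f half_gt_zero[OF e]] by blast
  obtain \<G> G where G: "finite \<G>" "\<G> \<subseteq> \<A>" "finite G"
    "\<forall>n. n \<notin> G \<longrightarrow> n \<notin> \<Union>\<G> \<longrightarrow> norm (g (Inl n)) < \<epsilon> / 2" "\<forall>A. A \<notin> \<G> \<longrightarrow> norm (g (Inr A)) < \<epsilon> / 2"
    using psi_C0_small[OF g half_gt_zero[OF e]] by blast
  have *: "\<not> \<epsilon> \<le> norm (a + b)" if "norm a < \<epsilon> / 2" "norm b < \<epsilon> / 2" for a b :: 'a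
    using that norm_triangle_ineq[of a b] by linarith
  have "n \<in> (F \<union> G) \<union> \<Union>(\<F> \<union> \<G>)" if "\<epsilon> \<le> norm (f (Inl n) + g (Inl n))" for n
    using *[OF F(4)[rule_format] G(4)[rule_format]] that by blast
  moreover have "A \<in> \<F> \<union> \<G>" if "\<epsilon> \<le> norm (f (Inr A) + g (Inr A))" for A
    using *[OF F(5)[rule_format] G(5)[rule_format]] that by blast
  ultimately show "\<exists>\<F> F. finite \<F> \<and> \<F> \<subseteq> \<A> \<and> finite F \<and> (\<forall>n. \<epsilon> \<le> norm (f (Inl n) + g (Inl n)) \<longrightarrow> n \<in> F \<union> \<Union>\<F>) \<and>
    (\<forall>A\<in>\<A>. \<epsilon> \<le> norm (f (Inr A) + g (Inr A)) \<longrightarrow> A \<in> \<F>)"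
    using F(1-3) G(1-3) by (intro exI[of _ "\<F> \<union> \<G>"] exI[of _ "F \<union> G"]) blast
next
  show "((\<lambda>n. f (Inl n) + g (Inl n)) \<longlongrightarrow> f (Inr A) + g (Inr A)) (along A)" if "A \<in> \<A>" for A
    using that by (intro tendsto_add psi_C0_tendsto[OF f] psi_C0_tendsto[OF g])
qed (simp add: psi_C0_zero[OF f] psi_C0_zero[OF g])

lemma psi_C0_scale:
  assumes f: "f \<in> psi_C0 \<A>"
  shows "(\<lambda>x. c * f x) \<in> psi_C0 \<A>"
proof (rule psi_C0_I)
  fix \<epsilon> :: real assume e: "\<epsilon> > 0"
  have "\<epsilon> / (norm c + 1) > 0" using e by (simp add: add_nonneg_pos)
  from psi_C0_small[OF f this] obtain \<F> F where F: "finite \<F>" "\<F> \<subseteq> \<A>" "finite F"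
    "\<forall>n. n \<notin> F \<longrightarrow> n \<notin> \<Union>\<F> \<longrightarrow> norm (f (Inl n)) < \<epsilon> / (norm c + 1)"
    "\<forall>A. A \<notin> \<F> \<longrightarrow> norm (f (Inr A)) < \<epsilon> / (norm c + 1)"
    by blast
  have *: "\<not> \<epsilon> \<le> norm (c * a)" if "norm a < \<epsilon> / (norm c + 1)" for a
  proof -
    have "norm (c * a) \<le> (norm c + 1) * norm a" by (simp add: norm_mult distrib_right)
    also have "\<dots> < \<epsilon>" using that by (simp add: pos_less_divide_eq add_nonneg_pos mult.commute)
    finally show ?thesis by simp
  qed
  have "n \<in> F \<union> \<Union>\<F>" if "\<epsilon> \<le> norm (c * f (Inl n))" for n
    using *[OF F(4)[rule_format]] that by blast
  moreover have "A \<in> \<F>" if "\<epsilon> \<le> norm (c * f (Inr A))" for A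
    using *[OF F(5)[rule_format]] that by blast
  ultimately show "\<exists>\<F> F. finite \<F> \<and> \<F> \<subseteq> \<A> \<and> finite F \<and> (\<forall>n. \<epsilon> \<le> norm (c * f (Inl n)) \<longrightarrow> n \<in> F \<union> \<Union>\<F>) \<and>
    (\<forall>A\<in>\<A>. \<epsilon> \<le> norm (c * f (Inr A)) \<longrightarrow> A \<in> \<F>)"
    using F(1-3) by blast
next
  show "((\<lambda>n. c * f (Inl n)) \<longlongrightarrow> c * f (Inr A)) (along A)" if "A \<in> \<A>" for A
    using that by (intro tendsto_mult_left psi_C0_tendsto[OF f])
qed (simp add: psi_C0_zero[OF f])

section \<open>Point masses, indicators and the density of their span\<close>

definition delta :: "nat \<Rightarrow> nat + nat set \<Rightarrow> 'k::real_normed_field" where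
  "delta m x = (if x = Inl m then 1 else 0)"

definition chi :: "nat set \<Rightarrow> nat + nat set \<Rightarrow> 'k::real_normed_field" where
  "chi A x = (if x \<in> psi_nbhd A {} then 1 else 0)"

lemma delta_simps: "delta m (Inl n) = (if n = m then 1 else 0)" "delta m (Inr A) = 0"
  by (auto simp: delta_def)

lemma chi_simps: "chi A (Inl n) = (if n \<in> A then 1 else 0)" "chi A (Inr B) = (if A = B then 1 else 0)"
  by (auto simp: chi_def psi_nbhd_def)

lemma delta_in_psi_C0: "(delta m :: _ \<Rightarrow> 'k::real_normed_field) \<in> psi_C0 \<A>"
proof (rule psi_C0_I)
  show "((\<lambda>n. delta m (Inl n) :: 'k) \<longlongrightarrow> delta m (Inr A)) (along A)" for A
    by (rule tendsto_eventually) (auto simp: delta_simps eventually_along intro!: exI[of _ "Suc m"])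
  fix \<epsilon> :: real assume "\<epsilon> > 0"
  then show "\<exists>\<F> F. finite \<F> \<and> \<F> \<subseteq> \<A> \<and> finite F \<and> (\<forall>n. \<epsilon> \<le> norm (delta m (Inl n) :: 'k) \<longrightarrow> n \<in> F \<union> \<Union>\<F>) \<and>
    (\<forall>A\<in>\<A>. \<epsilon> \<le> norm (delta m (Inr A) :: 'k) \<longrightarrow> A \<in> \<F>)"
    by (intro exI[of _ "{}"] exI[of _ "{m}"]) (auto simp: delta_simps)
qed (auto simp: delta_simps)

lemma almost_disjointD: "almost_disjoint \<A> \<Longrightarrow> A \<in> \<A> \<Longrightarrow> B \<in> \<A> \<Longrightarrow> A \<noteq> B \<Longrightarrow> finite (A \<inter> B)"
  unfolding almost_disjoint_def pairwise_def by blast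

lemma chi_in_psi_C0:
  assumes AD: "almost_disjoint \<A>" and A: "A \<in> \<A>"
  shows "(chi A :: _ \<Rightarrow> 'k::real_normed_field) \<in> psi_C0 \<A>"
proof (rule psi_C0_I)
  show "((\<lambda>n. chi A (Inl n) :: 'k) \<longlongrightarrow> chi A (Inr B)) (along B)" if B: "B \<in> \<A>" for B
  proof (rule tendsto_eventually, cases "A = B")
    case True
    then show "eventually (\<lambda>n. chi A (Inl n) = (chi A (Inr B) :: 'k)) (along B)"
      by (auto simp: chi_simps eventually_along)
  next
    case False
    show "eventually (\<lambda>n. chi A (Inl n) = (chi A (Inr B) :: 'k)) (along B)"
      using eventually_along_notin[OF almost_disjointD[OF AD A B False]]
      by eventually_elim (simp add: chi_simps False)
  qed
  fix \<epsilon> :: real assume "\<epsilon> > 0"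
  then show "\<exists>\<F> F. finite \<F> \<and> \<F> \<subseteq> \<A> \<and> finite F \<and> (\<forall>n. \<epsilon> \<le> norm (chi A (Inl n) :: 'k) \<longrightarrow> n \<in> F \<union> \<Union>\<F>) \<and>
    (\<forall>B\<in>\<A>. \<epsilon> \<le> norm (chi A (Inr B) :: 'k) \<longrightarrow> B \<in> \<F>)"
    using A by (intro exI[of _ "{A}"] exI[of _ "{}"]) (auto simp: chi_simps)
qed (use A in \<open>auto simp: chi_simps\<close>)

lemma psi_C0_sum:
  assumes "finite I" "\<And>i. i \<in> I \<Longrightarrow> h i \<in> psi_C0 \<A>"
  shows "(\<lambda>x. \<Sum>i\<in>I. c i * h i x) \<in> psi_C0 \<A>"
  using assms
proof (induction I)
  case empty
  show ?case using psi_C0_scale[OF delta_in_psi_C0, of 0] by simp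
next
  case (insert i I)
  then show ?case by (simp add: psi_C0_add psi_C0_scale)
qed

text \<open>Subtracting the indicators with coefficients \<open>f (Inr A)\<close> leaves a small
  function off a finite set of isolated points: the exceptional points of
  \<open>psi_C0_small\<close>, the overlaps of members of \<open>\<F>\<close>, and the points of
  each \<open>A\<close> where \<open>f\<close> is not yet close to its limit. Point masses correct
  \<open>f\<close> exactly on this set.\<close>

lemma psi_C0_approx:
  fixes f :: "nat + nat set \<Rightarrow> 'k::real_normed_field"
  assumes AD: "almost_disjoint \<A>" and f: "f \<in> psi_C0 \<A>" and e: "\<epsilon> > 0"
  obtains \<F> F c d where "finite \<F>" "\<F> \<subseteq> \<A>" "finite F"
    "\<And>x. norm (f x - ((\<Sum>A\<in>\<F>. c A * chi A x) + (\<Sum>m\<in>F. d m * delta m x))) \<le> \<epsilon>"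
proof -
  obtain \<F> F where F: "finite \<F>" "\<F> \<subseteq> \<A>" "finite F"
    "\<forall>n. n \<notin> F \<longrightarrow> n \<notin> \<Union>\<F> \<longrightarrow> norm (f (Inl n)) < \<epsilon>" "\<forall>A. A \<notin> \<F> \<longrightarrow> norm (f (Inr A)) < \<epsilon>"
    using psi_C0_small[OF f e] by blast
  define c where "c A = f (Inr A)" for A
  define s where "s x = (\<Sum>A\<in>\<F>. c A * chi A x)" for x
  define F' where "F' = F \<union> (\<Union>A\<in>\<F>. \<Union>B\<in>\<F> - {A}. A \<inter> B) \<union>
    (\<Union>A\<in>\<F>. {n \<in> A. \<epsilon> \<le> norm (f (Inl n) - f (Inr A))})"
  have "finite {n \<in> A. \<epsilon> \<le> norm (f (Inl n) - f (Inr A))}" if A: "A \<in> \<F>" for A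
    by (rule finite_large_along[OF psi_C0_tendsto[OF f] e]) (use A F(2) in blast)
  moreover have "finite (A \<inter> B)" if "A \<in> \<F>" "B \<in> \<F> - {A}" for A B
    using almost_disjointD[OF AD] that F(2) by blast
  ultimately have fin: "finite F'"
    unfolding F'_def using F(1,3) by (intro finite_UnI finite_UN_I) auto
  have s_Inr: "s (Inr B) = (if B \<in> \<F> then f (Inr B) else 0)" for B
    using F(1) by (simp add: s_def c_def chi_simps if_distrib[of "(*) _"] cong: if_cong)
  have s_Inl: "norm (f (Inl n) - s (Inl n)) \<le> \<epsilon>" if n: "n \<notin> F'" for n
  proof (cases "n \<in> \<Union>\<F>")
    case True
    then obtain A where A: "A \<in> \<F>" "n \<in> A" by blast
    have nB: "n \<notin> B" if "B \<in> \<F>" "B \<noteq> A" for B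
      using n A that unfolding F'_def by blast
    have "s (Inl n) = (\<Sum>B\<in>\<F>. if B = A then c A else 0)"
      unfolding s_def by (intro sum.cong refl) (simp add: chi_simps A(2) nB)
    also have "\<dots> = f (Inr A)" using A(1) F(1) by (simp add: c_def)
    finally have s: "s (Inl n) = f (Inr A)" .
    have "n \<notin> {n \<in> A. \<epsilon> \<le> norm (f (Inl n) - f (Inr A))}"
      using n A(1) unfolding F'_def by blast
    then show ?thesis using A(2) s by simp
  next
    case False
    then have "s (Inl n) = 0"
      unfolding s_def by (intro sum.neutral) (auto simp: chi_simps)
    then show ?thesis using F(4)[rule_format, of n] n False by (simp add: F'_def)
  qed
  define d where "d m = f (Inl m) - s (Inl m)" for m
  show thesis
  proof (rule that[of \<F> F' c d])
    fix x
    show "norm (f x - ((\<Sum>A\<in>\<F>. c A * chi A x) + (\<Sum>m\<in>F'. d m * delta m x))) \<le> \<epsilon>"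
    proof (cases x)
      case (Inl n)
      have "(\<Sum>m\<in>F'. d m * delta m x) = (if n \<in> F' then d n else 0)"
        using fin by (simp add: Inl delta_simps if_distrib[of "(*) _"] cong: if_cong)
      then show ?thesis using e s_Inl[of n] by (simp add: Inl d_def flip: s_def)
    next
      case (Inr B)
      then show ?thesis
        using F(5)[rule_format, of B] e s_Inr[of B] by (auto simp: delta_simps less_imp_le simp flip: s_def)
    qed
  qed (use F fin in auto)
qed

lemma countable_psi_C0_support:
  assumes "f \<in> psi_C0 \<A>"
  shows "countable {A. f (Inr A) \<noteq> 0}"
proof -
  have sub: "{A. f (Inr A) \<noteq> 0} \<subseteq> (\<Union>k. {A. inverse (real (Suc k)) \<le> norm (f (Inr A))})"
  proof
    fix A assume "A \<in> {A. f (Inr A) \<noteq> 0}"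
    then obtain k where "inverse (real (Suc k)) < norm (f (Inr A))"
      using reals_Archimedean[of "norm (f (Inr A))"] by auto
    then show "A \<in> (\<Union>k. {A. inverse (real (Suc k)) \<le> norm (f (Inr A))})" using less_imp_le by blast
  qed
  have fin: "finite {A. \<epsilon> \<le> norm (f (Inr A))}" if e: "\<epsilon> > 0" for \<epsilon> :: real
  proof -
    obtain \<F> where F: "finite \<F>" "\<forall>A. A \<notin> \<F> \<longrightarrow> norm (f (Inr A)) < \<epsilon>"
      using psi_C0_small[OF assms e] by blast
    then have "{A. \<epsilon> \<le> norm (f (Inr A))} \<subseteq> \<F>" by (auto simp: not_le[symmetric])
    then show ?thesis using F(1) by (rule finite_subset)
  qed
  have "countable {A. inverse (real (Suc k)) \<le> norm (f (Inr A))}" for k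
    by (rule countable_finite[OF fin]) simp
  then have "countable (\<Union>k. {A. inverse (real (Suc k)) \<le> norm (f (Inr A))})"
    by (intro countable_UN) auto
  with sub show ?thesis by (rule countable_subset)
qed

section \<open>Operators and their matrices\<close>

lemma bounded_operator_in: "bounded_operator E G T \<Longrightarrow> f \<in> E \<Longrightarrow> T f \<in> G"
  by (simp add: bounded_operator_def)

lemma bounded_operator_add:
  "bounded_operator E G T \<Longrightarrow> f \<in> E \<Longrightarrow> g \<in> E \<Longrightarrow> T (\<lambda>x. f x + g x) = (\<lambda>y. T f y + T g y)"
  by (simp add: bounded_operator_def)

lemma bounded_operator_scale:
  "bounded_operator E G T \<Longrightarrow> f \<in> E \<Longrightarrow> T (\<lambda>x. c * f x) = (\<lambda>y. c * T f y)"
  by (simp add: bounded_operator_def)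

lemma psi_C0_bound_nonneg:
  fixes T :: "(nat + nat set \<Rightarrow> 'k::real_normed_field) \<Rightarrow> nat + nat set \<Rightarrow> 'k"
  assumes "bounded_operator (psi_C0 \<A>) (psi_C0 \<A>) T"
  obtains K where "K \<ge> 0" "\<And>f x. f \<in> psi_C0 \<A> \<Longrightarrow> norm (T f x) \<le> K * sup_norm f"
proof -
  obtain B where B: "\<forall>f\<in>psi_C0 \<A>. sup_norm (T f) \<le> B * sup_norm f"
    and T: "\<forall>f\<in>psi_C0 \<A>. T f \<in> psi_C0 \<A>"
    using assms unfolding bounded_operator_def by blast
  show thesis
  proof (rule that[of "\<bar>B\<bar>"])
    fix f :: "nat + nat set \<Rightarrow> 'k" and x assume f: "f \<in> psi_C0 \<A>"
    have "0 \<le> sup_norm f"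
      using psi_C0_norm_le[OF f] norm_ge_zero order.trans by blast
    then have "B * sup_norm f \<le> \<bar>B\<bar> * sup_norm f" by (simp add: mult_right_mono)
    moreover have "norm (T f x) \<le> sup_norm (T f)" using T f psi_C0_norm_le by blast
    moreover have "sup_norm (T f) \<le> B * sup_norm f" using B f by blast
    ultimately show "norm (T f x) \<le> \<bar>B\<bar> * sup_norm f" by linarith
  qed simp
qed

text \<open>Signs in the scalar field, used to turn a sum of norms into one value of a
  functional.\<close>

lemma norming_scalars:
  fixes v :: "'i \<Rightarrow> 'k::real_normed_field"
  obtains u where "\<And>i. norm (u i) \<le> 1" "\<And>i. u i * v i = of_real (norm (v i))"
proof (rule that[of "\<lambda>i. if v i = 0 then 0 else of_real (norm (v i)) / v i"])
qed (auto simp: norm_divide)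

context
  fixes \<A> :: "nat set set" and T :: "(nat + nat set \<Rightarrow> 'k::{real_normed_field, banach}) \<Rightarrow> nat + nat set \<Rightarrow> 'k"
  assumes AD: "almost_disjoint \<A>" and inf: "\<And>A. A \<in> \<A> \<Longrightarrow> infinite A"
    and T: "bounded_operator (psi_C0 \<A>) (psi_C0 \<A>) T"
begin

lemmas T_in = bounded_operator_in[OF T]
lemmas T_add = bounded_operator_add[OF T]
lemmas T_scale = bounded_operator_scale[OF T]

lemma T_sum:
  assumes "finite I" "\<And>i. i \<in> I \<Longrightarrow> h i \<in> psi_C0 \<A>"
  shows "T (\<lambda>x. \<Sum>i\<in>I. c i * h i x) = (\<lambda>y. \<Sum>i\<in>I. c i * T (h i) y)"
  using assms
proof (induction I)
  case empty
  show ?case using T_scale[OF delta_in_psi_C0[of 0 \<A>], of 0] by simp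
next
  case (insert i I)
  then show ?case
    by (simp add: T_add[OF psi_C0_scale psi_C0_sum] T_scale)
qed

definition op_matrix :: "nat \<Rightarrow> nat \<Rightarrow> 'k" where
  "op_matrix n m = T (delta m) (Inl n)"

text \<open>A combination of distinct point masses with coefficients of norm at most 1 has sup norm
  at most 1; choosing signs as coefficients bounds every finite sum of norms in a row by the bound
  \<open>K\<close> of \<open>T\<close>.\<close>

lemma abs_summable_rows_op_matrix: "abs_summable_rows op_matrix"
proof -
  obtain K where K: "K \<ge> 0" "\<And>f x. f \<in> psi_C0 \<A> \<Longrightarrow> norm (T f x) \<le> K * sup_norm f"
    using psi_C0_bound_nonneg[OF T] by blast
  have "(\<Sum>m\<in>F. norm (op_matrix n m)) \<le> K" if F: "finite F" for F n
  proof -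
    obtain u where u: "\<And>m. norm (u m) \<le> 1" "\<And>m. u m * op_matrix n m = of_real (norm (op_matrix n m))"
      using norming_scalars[of "op_matrix n"] by blast
    define f where "f x = (\<Sum>m\<in>F. u m * delta m x)" for x
    have f: "f \<in> psi_C0 \<A>"
      unfolding f_def using F delta_in_psi_C0 by (rule psi_C0_sum)
    have "norm (f x) \<le> 1" for x
    proof (cases x)
      case (Inl k)
      have "f x = (if k \<in> F then u k else 0)"
        unfolding f_def using F by (simp add: Inl delta_simps if_distrib[of "(*) _"] cong: if_cong)
      then show ?thesis using u(1) by simp
    qed (simp add: f_def delta_simps)
    then have "sup_norm f \<le> 1" by (rule sup_norm_le)
    have "T f = (\<lambda>y. \<Sum>m\<in>F. u m * T (delta m) y)"
      unfolding f_def using F delta_in_psi_C0 by (rule T_sum)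
    then have "T f (Inl n) = of_real (\<Sum>m\<in>F. norm (op_matrix n m))"
      using u(2) by (simp add: op_matrix_def)
    then have "(\<Sum>m\<in>F. norm (op_matrix n m)) = norm (T f (Inl n))"
      by (simp only: norm_of_real) (simp add: sum_nonneg)
    also have "\<dots> \<le> K * sup_norm f" by (rule K(2)[OF f])
    also have "\<dots> \<le> K * 1" using K(1) \<open>sup_norm f \<le> 1\<close> by (intro mult_left_mono)
    finally show ?thesis by simp
  qed
  then have "(\<lambda>m. norm (op_matrix n m)) summable_on UNIV" for n
    by (intro nonneg_bdd_above_summable_on) (auto simp: bdd_above_def)
  then show ?thesis by (simp add: abs_summable_rows_def)
qed

text \<open>
  The defects \<open>T (chi A) n - row_sum op_matrix A n\<close>, \<open>A \<in> \<A>\<close>, are absolutely summable for each \<open>n\<close>: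
  finitely many members of \<open>\<A>\<close> become disjoint after a finite set is removed, which does not
  change the defects.
\<close>

lemma countable_non_matrix:
  "countable {A \<in> \<A>. \<exists>n. T (chi A) (Inl n) \<noteq> row_sum op_matrix A n}"
proof -
  note M = abs_summable_rows_op_matrix
  obtain K where K: "K \<ge> 0" "\<And>f x. f \<in> psi_C0 \<A> \<Longrightarrow> norm (T f x) \<le> K * sup_norm f"
    using psi_C0_bound_nonneg[OF T] by blast
  have "countable {A \<in> \<A>. T (chi A) (Inl n) - row_sum op_matrix A n \<noteq> 0}" for n
  proof -
    define d where "d A = T (chi A) (Inl n) - row_sum op_matrix A n" for A
    obtain u where u: "\<And>A. norm (u A) \<le> 1" "\<And>A. u A * d A = of_real (norm (d A))"
      using norming_scalars[of d] by blast
    have "(\<Sum>A\<in>\<F>. norm (d A)) \<le> K" if \<F>: "finite \<F>" "\<F> \<subseteq> \<A>" for \<F>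
    proof (rule field_le_epsilon)
      fix \<epsilon> :: real assume e: "\<epsilon> > 0"
      \<comment> \<open>The remainders of the row sums beyond \<open>N\<close> add up to at most
        \<open>card \<F> * \<eta>\<close>, hence at most \<open>\<epsilon>\<close>.\<close>
      define \<eta> where "\<eta> = \<epsilon> / (real (card \<F>) + 1)"
      have h: "\<eta> > 0" using e by (simp add: \<eta>_def)
      obtain L where L: "\<And>A. A \<subseteq> {L..} \<Longrightarrow> norm (row_sum op_matrix A n) \<le> \<eta>"
        using small_tail[OF M h] by blast
      have "finite (\<Union>A\<in>\<F>. \<Union>B\<in>\<F> - {A}. A \<inter> B)"
        using \<F> almost_disjointD[OF AD] by (intro finite_UN_I) auto
      then obtain L' where L': "(\<Union>A\<in>\<F>. \<Union>B\<in>\<F> - {A}. A \<inter> B) \<subseteq> {..<L'}"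
        using finite_nat_iff_bounded by blast
      \<comment> \<open>Beyond \<open>L\<close> row \<open>n\<close> is small; beyond
        \<open>L'\<close> the members of \<open>\<F>\<close> are disjoint, so the truncated
        indicators \<open>chi'\<close> have disjoint supports and their combination with the signs
        \<open>u\<close> has sup norm at most 1.\<close>
      define N where "N = max L L'"
      define chi' :: "nat set \<Rightarrow> nat + nat set \<Rightarrow> 'k"
        where "chi' A x = chi A x + (\<Sum>m\<in>A \<inter> {..<N}. (-1) * delta m x)" for A x
      have in1: "(chi A :: _ \<Rightarrow> 'k) \<in> psi_C0 \<A>" if "A \<in> \<F>" for A
        using chi_in_psi_C0[OF AD] that \<F>(2) by blast
      have in2: "(\<lambda>x. \<Sum>m\<in>A \<inter> {..<N}. (-1) * delta m x :: 'k) \<in> psi_C0 \<A>" for A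
        by (rule psi_C0_sum) (auto simp: delta_in_psi_C0)
      have in': "chi' A \<in> psi_C0 \<A>" if "A \<in> \<F>" for A
        unfolding chi'_def by (rule psi_C0_add[OF in1[OF that] in2])
      have chi'_Inl: "chi' A (Inl k) = (if k \<in> A \<and> N \<le> k then 1 else 0)" for A k
        by (auto simp: chi'_def chi_simps delta_simps sum_negf if_distrib[of uminus] cong: if_cong)
      have chi'_Inr: "chi' A (Inr B) = (if A = B then 1 else 0)" for A B
        by (simp add: chi'_def chi_simps delta_simps)
      have T': "T (chi' A) (Inl n) = d A + row_sum op_matrix (A \<inter> {N..}) n" if A: "A \<in> \<F>" for A
      proof -
        have "T (chi' A) (Inl n) = T (chi A) (Inl n) + (\<Sum>m\<in>A \<inter> {..<N}. (-1) * T (delta m) (Inl n))"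
          unfolding chi'_def T_add[OF in1[OF A] in2]
          by (subst T_sum) (auto simp: delta_in_psi_C0)
        also have "(\<Sum>m\<in>A \<inter> {..<N}. (-1) * T (delta m) (Inl n)) = - row_sum op_matrix (A \<inter> {..<N}) n"
          by (simp add: row_sum_finite[OF M] op_matrix_def sum_negf)
        also have "row_sum op_matrix A n = row_sum op_matrix (A \<inter> {..<N}) n + row_sum op_matrix (A \<inter> {N..}) n"
        proof -
          have "A = (A \<inter> {..<N}) \<union> (A \<inter> {N..})" by auto
          then show ?thesis using row_sum_Un[OF M, of "A \<inter> {..<N}" "A \<inter> {N..}" n] by force
        qed
        then have "T (chi A) (Inl n) + - row_sum op_matrix (A \<inter> {..<N}) n = d A + row_sum op_matrix (A \<inter> {N..}) n"
          by (simp add: d_def)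
        finally show ?thesis .
      qed
      define f where "f x = (\<Sum>A\<in>\<F>. u A * chi' A x)" for x
      have f: "f \<in> psi_C0 \<A>"
        unfolding f_def using \<F>(1) in' by (rule psi_C0_sum)
      have "norm (f x) \<le> 1" for x
      proof (cases x)
        case (Inr B)
        have "f x = (if B \<in> \<F> then u B else 0)"
          unfolding f_def using \<F>(1) by (simp add: Inr chi'_Inr if_distrib[of "(*) _"] cong: if_cong)
        then show ?thesis using u(1) by simp
      next
        case (Inl k)
        show ?thesis
        proof (cases "\<exists>A\<in>\<F>. k \<in> A \<and> N \<le> k")
          case True
          then obtain A where A: "A \<in> \<F>" "k \<in> A" "N \<le> k" by blast
          have nB: "k \<notin> B" if "B \<in> \<F>" "B \<noteq> A" for B
          proof
            assume "k \<in> B"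
            then have "k \<in> {..<L'}" using A that L' by blast
            with A(3) show False by (simp add: N_def)
          qed
          have "f x = (\<Sum>B\<in>\<F>. if B = A then u A else 0)"
            unfolding f_def Inl by (intro sum.cong refl) (simp add: chi'_Inl A nB)
          then show ?thesis using A(1) \<F>(1) u(1) by simp
        next
          case False
          then have "f x = 0" unfolding f_def Inl by (intro sum.neutral) (auto simp: chi'_Inl)
          then show ?thesis by simp
        qed
      qed
      then have "sup_norm f \<le> 1" by (rule sup_norm_le)
      then have "K * sup_norm f \<le> K * 1" using K(1) by (intro mult_left_mono)
      then have fK: "norm (T f (Inl n)) \<le> K" using K(2)[OF f, of "Inl n"] by simp
      have "T f = (\<lambda>y. \<Sum>A\<in>\<F>. u A * T (chi' A) y)"
        unfolding f_def using \<F>(1) in' by (rule T_sum)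
      then have "T f (Inl n) = (\<Sum>A\<in>\<F>. u A * d A + u A * row_sum op_matrix (A \<inter> {N..}) n)"
        by (simp add: T' distrib_left)
      also have "\<dots> = of_real (\<Sum>A\<in>\<F>. norm (d A)) + (\<Sum>A\<in>\<F>. u A * row_sum op_matrix (A \<inter> {N..}) n)"
        by (simp add: sum.distrib u(2))
      finally have "of_real (\<Sum>A\<in>\<F>. norm (d A)) = T f (Inl n) - (\<Sum>A\<in>\<F>. u A * row_sum op_matrix (A \<inter> {N..}) n)"
        by (simp add: algebra_simps)
      then have "norm (of_real (\<Sum>A\<in>\<F>. norm (d A)) :: 'k) \<le> norm (T f (Inl n)) + norm (\<Sum>A\<in>\<F>. u A * row_sum op_matrix (A \<inter> {N..}) n)"
        using norm_triangle_ineq4 by metis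
      moreover have "norm (\<Sum>A\<in>\<F>. u A * row_sum op_matrix (A \<inter> {N..}) n) \<le> (\<Sum>A\<in>\<F>. \<eta>)"
      proof (rule sum_norm_le)
        fix A
        have "norm (row_sum op_matrix (A \<inter> {N..}) n) \<le> \<eta>" by (rule L) (auto simp: N_def)
        then have "norm (u A) * norm (row_sum op_matrix (A \<inter> {N..}) n) \<le> 1 * \<eta>"
          using u(1) by (intro mult_mono) auto
        then show "norm (u A * row_sum op_matrix (A \<inter> {N..}) n) \<le> \<eta>" by (simp add: norm_mult)
      qed
      moreover have "(\<Sum>A\<in>\<F>. \<eta>) \<le> \<epsilon>"
        using e by (simp add: \<eta>_def field_simps)
      moreover have "norm (of_real (\<Sum>A\<in>\<F>. norm (d A)) :: 'k) = (\<Sum>A\<in>\<F>. norm (d A))"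
        unfolding norm_of_real by (simp add: sum_nonneg)
      ultimately show "(\<Sum>A\<in>\<F>. norm (d A)) \<le> K + \<epsilon>" using fK by linarith
    qed
    then have "(\<lambda>A. norm (d A)) summable_on \<A>"
      by (intro nonneg_bdd_above_summable_on) (auto simp: bdd_above_def)
    then have "countable {A \<in> \<A>. d A \<noteq> 0}" by (rule abs_summable_countable)
    then show ?thesis by (simp add: d_def)
  qed
  then have "countable (\<Union>n. {A \<in> \<A>. T (chi A) (Inl n) - row_sum op_matrix A n \<noteq> 0})"
    by (intro countable_UN) auto
  moreover have "{A \<in> \<A>. \<exists>n. T (chi A) (Inl n) \<noteq> row_sum op_matrix A n} =
    (\<Union>n. {A \<in> \<A>. T (chi A) (Inl n) - row_sum op_matrix A n \<noteq> 0})" by auto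
  ultimately show ?thesis by simp
qed

text \<open>Values at \<open>Inr B\<close> are limits along \<open>B\<close>, so an \<open>A\<close>
  that kills the matrix lies in one of the countable sets \<open>\<N>\<close> and
  \<open>\<D>\<close>. This rules out the first alternative of rigidity, and the second one provides
  \<open>l\<close>.\<close>

lemma operator_almost_scalar:
  assumes rigid: "matrix_rigid TYPE('k) \<A>"
  shows "\<exists>l \<C>. countable \<C> \<and> (\<forall>f\<in>psi_C0 \<A>. \<forall>B\<in>\<A> - \<C>. T f (Inr B) = l * f (Inr B))"
proof -
  define \<N> where "\<N> = {A \<in> \<A>. \<exists>n. T (chi A) (Inl n) \<noteq> row_sum op_matrix A n}"
  define \<D> where "\<D> = (\<Union>m. {B. T (delta m) (Inr B) \<noteq> 0})"
  have cN: "countable \<N>" unfolding \<N>_def by (rule countable_non_matrix)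
  have cD: "countable \<D>"
    unfolding \<D>_def using countable_psi_C0_support[OF T_in[OF delta_in_psi_C0]] by (intro countable_UN) auto
  have rs: "row_sum op_matrix A = (\<lambda>n. T (chi A) (Inl n))" if "A \<in> \<A> - \<N>" for A
    using that by (auto simp: \<N>_def)
  have chi_lim: "((\<lambda>n. T (chi A) (Inl n)) \<longlongrightarrow> T (chi A) (Inr B)) (along B)" if "A \<in> \<A>" "B \<in> \<A>" for A B
    by (rule psi_C0_tendsto[OF T_in[OF chi_in_psi_C0[OF AD that(1)]] that(2)])
  have "\<not> kills A op_matrix" if A: "A \<in> \<A> - \<N> - \<D>" for A
  proof -
    have "((\<lambda>n. op_matrix n m) \<longlongrightarrow> 0) (along A)" for m
      using psi_C0_tendsto[OF T_in[OF delta_in_psi_C0[of m]], of A] A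
      unfolding op_matrix_def \<D>_def by auto
    moreover have "(row_sum op_matrix A \<longlongrightarrow> T (chi A) (Inr A)) (along A)"
      using rs[of A] chi_lim[of A A] A by simp
    ultimately show ?thesis unfolding kills_def null_columns_def by blast
  qed
  then have "{A \<in> \<A>. kills A op_matrix} \<subseteq> \<N> \<union> \<D>" by blast
  then have "countable {A \<in> \<A>. kills A op_matrix}" using cN cD by (meson countable_Un countable_subset)
  with rigid[unfolded matrix_rigid_def, THEN spec, THEN mp, OF abs_summable_rows_op_matrix]
  obtain l \<C> where C: "countable \<C>" "\<forall>A\<in>\<A> - \<C>. null_columns op_matrix A \<and>
      (\<forall>B\<in>\<A> - \<C>. (row_sum op_matrix A \<longlongrightarrow> (if A = B then l else 0)) (along B))"
    by (elim disjE exE conjE) auto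
  \<comment> \<open>The matrix gives no control over \<open>T (chi A)\<close> for the countably many
    exceptional \<open>A\<close>, but this function vanishes at all but countably many
    \<open>Inr B\<close>. After these \<open>B\<close> are discarded both sides of the identity are
    0, as \<open>A\<close> differs from \<open>B\<close>.\<close>
  define \<C>' where "\<C>' = \<C> \<union> \<N> \<union> \<D> \<union> (\<Union>A\<in>\<A> \<inter> (\<C> \<union> \<N>). {B. T (chi A) (Inr B) \<noteq> 0})"
  have "countable {B. T (chi A) (Inr B) \<noteq> 0}" if "A \<in> \<A>" for A
    by (rule countable_psi_C0_support[OF T_in[OF chi_in_psi_C0[OF AD that]]])
  then have "countable (\<Union>A\<in>\<A> \<inter> (\<C> \<union> \<N>). {B. T (chi A) (Inr B) \<noteq> 0})"
    using C(1) cN by (intro countable_UN) auto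
  then have cC': "countable \<C>'"
    using C(1) cN cD by (simp add: \<C>'_def)
  have "T f (Inr B) = l * f (Inr B)" if f: "f \<in> psi_C0 \<A>" and B: "B \<in> \<A> - \<C>'" for f B
  proof -
    have d: "T (delta m) (Inr B) = 0" for m using B by (auto simp: \<C>'_def \<D>_def)
    have c: "T (chi A) (Inr B) = l * chi A (Inr B)" if A: "A \<in> \<A>" for A
    proof (cases "A \<in> \<C> \<union> \<N>")
      case True
      then have "A \<noteq> B" using B by (auto simp: \<C>'_def)
      moreover have "T (chi A) (Inr B) = 0" using True A B by (auto simp: \<C>'_def)
      ultimately show ?thesis by (simp add: chi_simps)
    next
      case False
      then have "(row_sum op_matrix A \<longlongrightarrow> (if A = B then l else 0)) (along B)"
        using A B C(2) by (auto simp: \<C>'_def)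
      moreover have "(row_sum op_matrix A \<longlongrightarrow> T (chi A) (Inr B)) (along B)"
        using rs[of A] chi_lim[of A B] A B False by simp
      moreover have "along B \<noteq> bot" using inf B by (intro along_neq_bot) auto
      ultimately have "T (chi A) (Inr B) = (if A = B then l else 0)"
        using tendsto_unique by blast
      then show ?thesis by (simp add: chi_simps)
    qed
    \<comment> \<open>The identity at \<open>B\<close> now holds for all point masses and
      indicators; density of their span and boundedness carry it over to \<open>f\<close>.\<close>
    obtain K where K: "K \<ge> 0" "\<And>f x. f \<in> psi_C0 \<A> \<Longrightarrow> norm (T f x) \<le> K * sup_norm f"
      using psi_C0_bound_nonneg[OF T] by blast
    have "norm (T f (Inr B) - l * f (Inr B)) \<le> 0 + \<epsilon>" if e: "\<epsilon> > 0" for \<epsilon> :: real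
    proof -
      define \<eta> where "\<eta> = \<epsilon> / (K + norm l + 1)"
      have pos: "K + norm l + 1 > 0" using K(1) by (simp add: add_nonneg_pos)
      have h: "\<eta> > 0" using e pos by (simp add: \<eta>_def)
      obtain \<F> F a b where F: "finite \<F>" "\<F> \<subseteq> \<A>" "finite F"
        "\<And>x. norm (f x - ((\<Sum>A\<in>\<F>. a A * chi A x) + (\<Sum>m\<in>F. b m * delta m x))) \<le> \<eta>"
        using psi_C0_approx[OF AD f h] by blast
      have in_chi: "\<And>A. A \<in> \<F> \<Longrightarrow> (chi A :: _ \<Rightarrow> 'k) \<in> psi_C0 \<A>"
        using F(2) chi_in_psi_C0[OF AD] by blast
      define g where "g x = (\<Sum>A\<in>\<F>. a A * chi A x) + (\<Sum>m\<in>F. b m * delta m x)" for x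
      have g1: "(\<lambda>x. \<Sum>A\<in>\<F>. a A * chi A x) \<in> psi_C0 \<A>"
        by (rule psi_C0_sum[OF F(1) in_chi])
      have g2: "(\<lambda>x. \<Sum>m\<in>F. b m * delta m x) \<in> psi_C0 \<A>"
        by (rule psi_C0_sum[OF F(3) delta_in_psi_C0])
      have g: "g \<in> psi_C0 \<A>"
        unfolding g_def by (rule psi_C0_add[OF g1 g2])
      have t1: "T (\<lambda>x. \<Sum>A\<in>\<F>. a A * chi A x) = (\<lambda>y. \<Sum>A\<in>\<F>. a A * T (chi A) y)"
        using F(1) in_chi by (rule T_sum)
      have "T g = (\<lambda>y. (\<Sum>A\<in>\<F>. a A * T (chi A) y) + (\<Sum>m\<in>F. b m * T (delta m) y))"
        unfolding g_def T_add[OF g1 g2] t1 T_sum[OF F(3) delta_in_psi_C0] ..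
      then have "T g (Inr B) = (\<Sum>A\<in>\<F>. a A * (l * chi A (Inr B)))"
        using F(2) c d by (auto intro!: sum.cong)
      also have "\<dots> = l * g (Inr B)"
        by (simp add: g_def delta_simps sum_distrib_left mult.left_commute)
      finally have Tg: "T g (Inr B) = l * g (Inr B)" .
      define h where "h x = f x + (-1) * g x" for x
      have h_in: "h \<in> psi_C0 \<A>" unfolding h_def by (rule psi_C0_add[OF f psi_C0_scale[OF g]])
      have hx: "norm (h x) \<le> \<eta>" for x using F(4)[of x] by (simp add: h_def flip: g_def)
      then have "sup_norm h \<le> \<eta>" by (rule sup_norm_le)
      have "T h = (\<lambda>y. T f y + (-1) * T g y)"
        unfolding h_def T_add[OF f psi_C0_scale[OF g]] T_scale[OF g] ..
      then have "T f (Inr B) - l * f (Inr B) = T h (Inr B) - l * h (Inr B)"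
        by (simp add: Tg h_def algebra_simps)
      also have "norm \<dots> \<le> norm (T h (Inr B)) + norm (l * h (Inr B))" by (rule norm_triangle_ineq4)
      also have "\<dots> \<le> K * \<eta> + norm l * \<eta>"
      proof (rule add_mono)
        have "norm (T h (Inr B)) \<le> K * sup_norm h" by (rule K(2)[OF h_in])
        also have "\<dots> \<le> K * \<eta>" using K(1) \<open>sup_norm h \<le> \<eta>\<close> by (intro mult_left_mono)
        finally show "norm (T h (Inr B)) \<le> K * \<eta>" .
        show "norm (l * h (Inr B)) \<le> norm l * \<eta>" using hx by (simp add: norm_mult mult_left_mono)
      qed
      also have "\<dots> \<le> (K + norm l + 1) * \<eta>" using h by (simp add: algebra_simps)
      also have "\<dots> = \<epsilon>" using pos by (simp add: \<eta>_def)
      finally show ?thesis by simp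
    qed
    then have "norm (T f (Inr B) - l * f (Inr B)) \<le> 0" by (rule field_le_epsilon)
    then show ?thesis by simp
  qed
  with cC' show ?thesis by blast
qed

end

section \<open>Factorization through \<open>c\<^sub>0\<close>\<close>

lemma tendsto_zero_iff_finite:
  fixes u :: "nat \<Rightarrow> 'k::real_normed_vector"
  shows "u \<longlonglongrightarrow> 0 \<longleftrightarrow> (\<forall>\<epsilon>>0. finite {k. \<epsilon> \<le> norm (u k)})"
  by (simp add: tendsto_iff eventually_cofinite not_less flip: cofinite_eq_sequentially)

lemma c0_norm_le: "u \<in> c0_space \<Longrightarrow> norm (u k) \<le> sup_norm u"
proof (rule norm_le_sup_norm)
  assume "u \<in> c0_space"
  then have "Bseq u" by (auto simp: c0_space_def intro: convergent_imp_Bseq convergentI)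
  then obtain b where "\<forall>k. norm (u k) \<le> b" by (auto simp: Bseq_def)
  then show "bdd_above (range (\<lambda>k. norm (u k)))" by (auto simp: bdd_above_def)
qed

context
  fixes \<A> \<D> :: "nat set set"
  assumes AD: "almost_disjoint \<A>" and D: "\<D> \<subseteq> \<A>" "countable \<D>"
begin

text \<open>
  The countable family \<open>\<D>\<close> is made disjoint by assigning \<open>n\<close> to the member of least index
  that contains it; all but finitely many elements of \<open>A \<in> \<D>\<close> keep \<open>A\<close> as their owner. The odd
  coordinates of the sequence \<open>to_c0 g\<close> hold the values of \<open>g\<close> at the points \<open>y\<^sub>A\<close>, the even ones the
  deviation of \<open>g\<close> at \<open>x\<^sub>n\<close> from its value at the point of the owner of \<open>n\<close>.
\<close>

definition idx :: "nat set \<Rightarrow> nat" where "idx = to_nat_on \<D>"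

definition owned :: "nat \<Rightarrow> bool" where "owned n \<longleftrightarrow> (\<exists>A\<in>\<D>. n \<in> A)"

definition owner :: "nat \<Rightarrow> nat set" where "owner n = arg_min idx (\<lambda>A. A \<in> \<D> \<and> n \<in> A)"

lemma inj_idx: "inj_on idx \<D>"
  unfolding idx_def using D(2) by (rule inj_on_to_nat_on)

lemma owner:
  assumes "owned n"
  shows "owner n \<in> \<D>" "n \<in> owner n" "\<And>A. A \<in> \<D> \<Longrightarrow> n \<in> A \<Longrightarrow> idx (owner n) \<le> idx A"
proof -
  obtain B where B: "B \<in> \<D> \<and> n \<in> B" using assms by (auto simp: owned_def)
  show "owner n \<in> \<D>" "n \<in> owner n" "\<And>A. A \<in> \<D> \<Longrightarrow> n \<in> A \<Longrightarrow> idx (owner n) \<le> idx A"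
    unfolding owner_def using arg_min_nat_lemma[of "\<lambda>A. A \<in> \<D> \<and> n \<in> A", OF B, of idx] by auto
qed

lemma ownedI: "A \<in> \<D> \<Longrightarrow> n \<in> A \<Longrightarrow> owned n"
  by (auto simp: owned_def)

text \<open>An owner other than \<open>A\<close> has a smaller index. There are finitely many such
  members of \<open>\<D>\<close>, and each meets \<open>A\<close> in a finite set.\<close>

lemma finite_not_owner:
  assumes A: "A \<in> \<D>"
  shows "finite {n \<in> A. owner n \<noteq> A}"
proof -
  let ?E = "{B \<in> \<D>. idx B < idx A}"
  have "finite ?E"
    by (rule inj_on_finite[of idx _ "{..<idx A}"]) (auto intro: inj_on_subset[OF inj_idx])
  moreover have "finite (B \<inter> A)" if "B \<in> ?E" for B
    using almost_disjointD[OF AD, of B A] that A D(1) by auto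
  ultimately have "finite (\<Union>B\<in>?E. B \<inter> A)" by (rule finite_UN_I)
  moreover have "{n \<in> A. owner n \<noteq> A} \<subseteq> (\<Union>B\<in>?E. B \<inter> A)"
  proof
    fix n assume "n \<in> {n \<in> A. owner n \<noteq> A}"
    then have n: "n \<in> A" "owner n \<noteq> A" by auto
    note o = owner[OF ownedI[OF A n(1)]]
    have "idx (owner n) \<noteq> idx A" using inj_onD[OF inj_idx _ o(1) A] n(2) by blast
    then have "idx (owner n) < idx A" using o(3)[OF A n(1)] by simp
    then show "n \<in> (\<Union>B\<in>?E. B \<inter> A)" using o(1,2) n(1) by blast
  qed
  ultimately show ?thesis by (rule finite_subset[rotated])
qed

definition to_c0 :: "(nat + nat set \<Rightarrow> 'k::real_normed_field) \<Rightarrow> nat \<Rightarrow> 'k" where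
  "to_c0 g k = (let n = k div 2 in
     if even k then g (Inl n) - (if owned n then g (Inr (owner n)) else 0)
     else if n \<in> idx ` \<D> then g (Inr (inv_into \<D> idx n)) else 0)"

definition of_c0 :: "(nat \<Rightarrow> 'k::real_normed_field) \<Rightarrow> nat + nat set \<Rightarrow> 'k" where
  "of_c0 u x = (case x of
     Inl n \<Rightarrow> u (2 * n) + (if owned n then u (Suc (2 * idx (owner n))) else 0)
   | Inr A \<Rightarrow> if A \<in> \<D> then u (Suc (2 * idx A)) else 0)"

lemma to_c0_even: "to_c0 g (2 * n) = g (Inl n) - (if owned n then g (Inr (owner n)) else 0)"
  by (simp add: to_c0_def)

lemma to_c0_idx: "A \<in> \<D> \<Longrightarrow> to_c0 g (Suc (2 * idx A)) = g (Inr A)"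
  using inj_idx by (simp add: to_c0_def)

lemma of_c0_to_c0:
  assumes "\<And>A. A \<notin> \<D> \<Longrightarrow> g (Inr A) = 0"
  shows "of_c0 (to_c0 g) = g"
proof
  fix x
  show "of_c0 (to_c0 g) x = g x"
    using assms owner(1) by (cases x) (auto simp: of_c0_def to_c0_even to_c0_idx)
qed

text \<open>Off the finite set \<open>X\<close> the even coordinates are small. If the owner of
  \<open>n\<close> belongs to \<open>\<F>\<close>, then \<open>g\<close> is already within
  \<open>\<epsilon>\<close> of its limit there. Otherwise \<open>n\<close> lies in no member of
  \<open>\<F> \<inter> \<D>\<close>, and the value at \<open>n\<close> and the value at the owner,
  if there is one, are each below \<open>\<epsilon> / 2\<close>; for \<open>A\<close> in
  \<open>\<F> - \<D>\<close> this uses that the limit of \<open>g\<close> is 0.\<close>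

lemma to_c0_in:
  fixes g :: "nat + nat set \<Rightarrow> 'k::real_normed_field"
  assumes g: "g \<in> psi_C0 \<A>" and zero: "\<And>A. A \<notin> \<D> \<Longrightarrow> g (Inr A) = 0"
  shows "to_c0 g \<in> c0_space"
  unfolding c0_space_def mem_Collect_eq tendsto_zero_iff_finite
proof (intro allI impI)
  fix \<epsilon> :: real assume e: "\<epsilon> > 0"
  obtain \<F> F where F: "finite \<F>" "\<F> \<subseteq> \<A>" "finite F"
    "\<forall>n. n \<notin> F \<longrightarrow> n \<notin> \<Union>\<F> \<longrightarrow> norm (g (Inl n)) < \<epsilon> / 2" "\<forall>A. A \<notin> \<F> \<longrightarrow> norm (g (Inr A)) < \<epsilon> / 2"
    using psi_C0_small[OF g half_gt_zero[OF e]] by blast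
  define X where "X = F \<union> (\<Union>A\<in>\<F> \<inter> \<D>. {n \<in> A. owner n \<noteq> A} \<union> {n \<in> A. \<epsilon> \<le> norm (g (Inl n) - g (Inr A))})
    \<union> (\<Union>A\<in>\<F> - \<D>. {n \<in> A. \<epsilon> / 2 \<le> norm (g (Inl n) - g (Inr A))})"
  have "finite {n \<in> A. \<epsilon> \<le> norm (g (Inl n) - g (Inr A))}" "finite {n \<in> A. \<epsilon> / 2 \<le> norm (g (Inl n) - g (Inr A))}"
    if "A \<in> \<F>" for A
    by (rule finite_large_along[OF psi_C0_tendsto[OF g]]; use that F(2) e in auto)+
  then have "finite X"
    unfolding X_def using F(1,3) finite_not_owner by (intro finite_UnI finite_UN_I) auto
  have X: "n \<in> X" if n: "\<epsilon> \<le> norm (to_c0 g (2 * n))" for n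
  proof (rule ccontr)
    assume nX: "n \<notin> X"
    have small: "norm (g (Inl n)) < \<epsilon> / 2" if "\<And>A. A \<in> \<F> \<Longrightarrow> n \<in> A \<Longrightarrow> A \<notin> \<D>"
    proof (cases "n \<in> \<Union>\<F>")
      case True
      then obtain A where A: "A \<in> \<F>" "n \<in> A" by blast
      then have "A \<notin> \<D>" using that by blast
      then have "n \<notin> {n \<in> A. \<epsilon> / 2 \<le> norm (g (Inl n) - g (Inr A))}"
        using nX A(1) unfolding X_def by blast
      then show ?thesis using A(2) zero[OF \<open>A \<notin> \<D>\<close>] by simp
    qed (use nX F(4) in \<open>auto simp: X_def\<close>)
    show False
    proof (cases "owned n")
      case True
      note o = owner(1,2)[OF True]
      have val: "\<epsilon> \<le> norm (g (Inl n) - g (Inr (owner n)))" using n True by (simp add: to_c0_even)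
      show False
      proof (cases "owner n \<in> \<F>")
        case True
        then have "n \<notin> {m \<in> owner n. \<epsilon> \<le> norm (g (Inl m) - g (Inr (owner n)))}"
          using nX o(1) unfolding X_def by blast
        then show False using o(2) val by simp
      next
        case False
        have "A \<notin> \<D>" if "A \<in> \<F>" "n \<in> A" for A
        proof
          assume "A \<in> \<D>"
          then have "n \<notin> {n \<in> A. owner n \<noteq> A}" using nX that(1) unfolding X_def by blast
          then show False using that False by auto
        qed
        then have "norm (g (Inl n)) < \<epsilon> / 2" by (rule small)
        moreover have "norm (g (Inr (owner n))) < \<epsilon> / 2" using F(5) False by blast
        ultimately show False
          using val norm_triangle_ineq4[of "g (Inl n)" "g (Inr (owner n))"] by simp
      qed
    next
      case False
      then have "norm (g (Inl n)) < \<epsilon> / 2" using small ownedI by blast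
      then show False using n False e by (simp add: to_c0_even)
    qed
  qed
  have "{k. \<epsilon> \<le> norm (to_c0 g k)} \<subseteq> (\<lambda>n. 2 * n) ` X \<union> (\<lambda>A. Suc (2 * idx A)) ` \<F>"
  proof
    fix k assume "k \<in> {k. \<epsilon> \<le> norm (to_c0 g k)}"
    then have k: "\<epsilon> \<le> norm (to_c0 g k)" by simp
    show "k \<in> (\<lambda>n. 2 * n) ` X \<union> (\<lambda>A. Suc (2 * idx A)) ` \<F>"
    proof (cases "even k")
      case True
      then obtain n where "k = 2 * n" by blast
      then show ?thesis using X k by blast
    next
      case False
      then obtain n where n: "k = Suc (2 * n)" using oddE by fastforce
      then have "n \<in> idx ` \<D>" using k e by (auto simp: to_c0_def split: if_splits)
      then obtain A where A: "A \<in> \<D>" "n = idx A" by blast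
      then have "\<epsilon> \<le> norm (g (Inr A))" using k n to_c0_idx[OF A(1), of g] by simp
      then have "A \<in> \<F>" using F(5) e by fastforce
      then show ?thesis using n A(2) by blast
    qed
  qed
  then show "finite {k. \<epsilon> \<le> norm (to_c0 g k)}"
    using \<open>finite X\<close> F(1) by (meson finite_UnI finite_imageI finite_subset)
qed

text \<open>Continuity at \<open>Inr A\<close>: if \<open>A\<close> is in \<open>\<D>\<close>, then
  \<open>A\<close> is the owner of almost all of its elements. If not, the finitely many members of
  \<open>\<D>\<close> with a large coordinate meet \<open>A\<close> in a finite set, so the
  contribution of the owners tends to 0.\<close>

lemma of_c0_in:
  fixes u :: "nat \<Rightarrow> 'k::real_normed_field"
  assumes u: "u \<in> c0_space"
  shows "of_c0 u \<in> psi_C0 \<A>"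
proof -
  have u0: "u \<longlonglongrightarrow> 0" using u by (simp add: c0_space_def)
  have fin: "finite {k. \<epsilon> \<le> norm (u k)}" if "\<epsilon> > 0" for \<epsilon>
    using u0 that unfolding tendsto_zero_iff_finite by blast
  have finE: "finite {n. \<epsilon> \<le> norm (u (2 * n))}" if "\<epsilon> > 0" for \<epsilon>
    using finite_vimageI[OF fin[OF that], of "\<lambda>n. 2 * n"] by (simp add: vimage_def inj_def)
  have finO: "finite {A \<in> \<D>. \<epsilon> \<le> norm (u (Suc (2 * idx A)))}" if "\<epsilon> > 0" for \<epsilon>
  proof (rule inj_on_finite[of "\<lambda>A. Suc (2 * idx A)", OF _ _ fin[OF that]])
    show "inj_on (\<lambda>A. Suc (2 * idx A)) {A \<in> \<D>. \<epsilon> \<le> norm (u (Suc (2 * idx A)))}"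
      using inj_idx by (auto simp: inj_on_def)
  qed auto
  have even0: "((\<lambda>n. u (2 * n)) \<longlongrightarrow> 0) (along A)" for A
  proof -
    have "(\<lambda>n. u (2 * n)) \<longlonglongrightarrow> 0"
      unfolding tendsto_zero_iff_finite using finE by blast
    then show ?thesis by (rule tendsto_mono[OF inf_le1])
  qed
  show ?thesis
  proof (rule psi_C0_I)
    show "of_c0 u (Inr A) = 0" if "A \<notin> \<A>" for A
      using that D(1) by (auto simp: of_c0_def)
    show "((\<lambda>n. of_c0 u (Inl n)) \<longlongrightarrow> of_c0 u (Inr A)) (along A)" if A: "A \<in> \<A>" for A
    proof -
      have "((\<lambda>n. if owned n then u (Suc (2 * idx (owner n))) else 0) \<longlongrightarrow>
        (if A \<in> \<D> then u (Suc (2 * idx A)) else 0)) (along A)"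
      proof (cases "A \<in> \<D>")
        case True
        have "eventually (\<lambda>n. n \<notin> {n \<in> A. owner n \<noteq> A}) (along A)"
          using finite_not_owner[OF True] by (intro eventually_along_notin) simp
        moreover have "eventually (\<lambda>n. n \<in> A) (along A)" unfolding eventually_along by blast
        ultimately have "eventually (\<lambda>n. (if owned n then u (Suc (2 * idx (owner n))) else 0) = u (Suc (2 * idx A))) (along A)"
          by eventually_elim (use True ownedI in auto)
        then show ?thesis using True by (simp add: tendsto_eventually)
      next
        case False
        have "\<exists>N. \<forall>n\<in>A. N \<le> n \<longrightarrow> norm ((if owned n then u (Suc (2 * idx (owner n))) else 0) - 0) < \<epsilon>"
          if e: "\<epsilon> > 0" for \<epsilon>
        proof -
          let ?E = "{B \<in> \<D>. \<epsilon> \<le> norm (u (Suc (2 * idx B)))}"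
          have "finite (B \<inter> A)" if "B \<in> ?E" for B
            using almost_disjointD[OF AD, of B A] that A False D(1) by blast
          then have "finite (\<Union>B\<in>?E. B \<inter> A)" by (rule finite_UN_I[OF finO[OF e]])
          then have "eventually (\<lambda>n. n \<notin> (\<Union>B\<in>?E. B \<inter> A)) (along A)"
            by (intro eventually_along_notin) simp
          then obtain N where N: "\<forall>n\<in>A. N \<le> n \<longrightarrow> n \<notin> (\<Union>B\<in>?E. B \<inter> A)"
            unfolding eventually_along ..
          have "norm ((if owned n then u (Suc (2 * idx (owner n))) else 0) - 0) < \<epsilon>" if n: "n \<in> A" "N \<le> n" for n
          proof (cases "owned n")
            case True
            have "owner n \<notin> ?E" using N n owner(2)[OF True] by blast
            then show ?thesis using True owner(1)[OF True] by simp
          qed (use e in simp)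
          then show ?thesis by blast
        qed
        then show ?thesis using False unfolding tendsto_along_iff by simp
      qed
      from tendsto_add[OF even0 this] show ?thesis by (simp add: of_c0_def)
    qed
    fix \<epsilon> :: real assume e: "\<epsilon> > 0"
    then have h: "\<epsilon> / 2 > 0" by simp
    let ?\<F> = "{A \<in> \<D>. \<epsilon> / 2 \<le> norm (u (Suc (2 * idx A)))}" and ?F = "{n. \<epsilon> / 2 \<le> norm (u (2 * n))}"
    have "n \<in> ?F \<union> \<Union>?\<F>" if n: "\<epsilon> \<le> norm (of_c0 u (Inl n))" for n
    proof (rule ccontr)
      assume not: "n \<notin> ?F \<union> \<Union>?\<F>"
      have "norm (if owned n then u (Suc (2 * idx (owner n))) else 0) < \<epsilon> / 2"
      proof (cases "owned n")
        case True
        then have "owner n \<notin> ?\<F>" using not owner(2) by blast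
        then show ?thesis using True owner(1) by simp
      qed (use e in simp)
      moreover have "norm (u (2 * n)) < \<epsilon> / 2" using not by auto
      ultimately show False
        using n norm_triangle_ineq[of "u (2 * n)" "if owned n then u (Suc (2 * idx (owner n))) else 0"]
        by (simp add: of_c0_def)
    qed
    moreover have "A \<in> ?\<F>" if "\<epsilon> \<le> norm (of_c0 u (Inr A))" for A
      using that e by (auto simp: of_c0_def split: if_splits)
    moreover have "?\<F> \<subseteq> \<A>" using D(1) by blast
    ultimately show "\<exists>\<F> F. finite \<F> \<and> \<F> \<subseteq> \<A> \<and> finite F \<and>
      (\<forall>n. \<epsilon> \<le> norm (of_c0 u (Inl n)) \<longrightarrow> n \<in> F \<union> \<Union>\<F>) \<and> (\<forall>A\<in>\<A>. \<epsilon> \<le> norm (of_c0 u (Inr A)) \<longrightarrow> A \<in> \<F>)"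
      using finO[OF h] finE[OF h] by (intro exI[of _ ?\<F>] exI[of _ ?F]) blast
  qed
qed

lemma norm_to_c0_le:
  fixes g :: "nat + nat set \<Rightarrow> 'k::real_normed_field"
  assumes "\<And>x. norm (g x) \<le> b"
  shows "norm (to_c0 g k) \<le> 2 * b"
proof -
  have b: "0 \<le> b" using assms norm_ge_zero order.trans by blast
  have "norm (to_c0 g k) \<le> b + b"
    using norm_triangle_ineq4[of "g (Inl (k div 2))" "g (Inr (owner (k div 2)))"]
      assms[of "Inl (k div 2)"] assms[of "Inr (owner (k div 2))"] assms[of "Inr (inv_into \<D> idx (k div 2))"] b
    by (auto simp: to_c0_def Let_def)
  then show ?thesis by simp
qed

lemma norm_of_c0_le:
  fixes u :: "nat \<Rightarrow> 'k::real_normed_field"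
  assumes "\<And>k. norm (u k) \<le> b"
  shows "norm (of_c0 u x) \<le> 2 * b"
proof -
  have b: "0 \<le> b" using assms norm_ge_zero order.trans by blast
  show ?thesis
  proof (cases x)
    case (Inl n)
    show ?thesis
      using norm_triangle_ineq[of "u (2 * n)" "u (Suc (2 * idx (owner n)))"]
        assms[of "2 * n"] assms[of "Suc (2 * idx (owner n))"] b
      by (auto simp: of_c0_def Inl)
  next
    case (Inr A)
    show ?thesis using assms[of "Suc (2 * idx A)"] b by (auto simp: of_c0_def Inr)
  qed
qed

text \<open>In general \<open>to_c0\<close> yields null sequences only for functions that vanish at
  the points outside \<open>\<D>\<close>, so the first factor is \<open>to_c0\<close> after
  \<open>S\<close>; \<open>of_c0\<close> then restores \<open>S f\<close>.\<close>

lemma factors_through_c0_if_supported: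
  fixes S :: "(nat + nat set \<Rightarrow> 'k::real_normed_field) \<Rightarrow> nat + nat set \<Rightarrow> 'k"
  assumes S: "bounded_operator (psi_C0 \<A>) (psi_C0 \<A>) S"
    and zero: "\<And>f A. f \<in> psi_C0 \<A> \<Longrightarrow> A \<in> \<A> - \<D> \<Longrightarrow> S f (Inr A) = 0"
  shows "factors_through_c0 (psi_C0 \<A>) S"
  unfolding factors_through_c0_def
proof (intro exI conjI ballI)
  have S_in: "S f \<in> psi_C0 \<A>" if "f \<in> psi_C0 \<A>" for f
    using S that by (simp add: bounded_operator_def)
  have S0: "S f (Inr A) = 0" if "f \<in> psi_C0 \<A>" "A \<notin> \<D>" for f A
    using zero[OF that(1), of A] psi_C0_zero[OF S_in[OF that(1)], of A] that(2) by blast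
  obtain K where K: "\<And>f x. f \<in> psi_C0 \<A> \<Longrightarrow> norm (S f x) \<le> K * sup_norm f"
    using psi_C0_bound_nonneg[OF S] by metis
  show "bounded_operator (psi_C0 \<A>) c0_space (\<lambda>f. to_c0 (S f))"
    unfolding bounded_operator_def
  proof (intro conjI ballI allI exI)
    show "to_c0 (S f) \<in> c0_space" if "f \<in> psi_C0 \<A>" for f
      by (rule to_c0_in[OF S_in[OF that] S0[OF that]])
    show "to_c0 (S (\<lambda>x. f x + g x)) = (\<lambda>y. to_c0 (S f) y + to_c0 (S g) y)"
      if "f \<in> psi_C0 \<A>" "g \<in> psi_C0 \<A>" for f g
      using S that by (auto simp: bounded_operator_def to_c0_def Let_def fun_eq_iff)
    show "to_c0 (S (\<lambda>x. c * f x)) = (\<lambda>y. c * to_c0 (S f) y)" if "f \<in> psi_C0 \<A>" for c f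
      using S that by (auto simp: bounded_operator_def to_c0_def Let_def fun_eq_iff right_diff_distrib)
    show "sup_norm (to_c0 (S f)) \<le> (2 * K) * sup_norm f" if "f \<in> psi_C0 \<A>" for f
      using norm_to_c0_le[of "S f", OF K[OF that]] by (intro sup_norm_le) (simp add: mult.assoc)
  qed
  show "bounded_operator c0_space (psi_C0 \<A>) (of_c0 :: (nat \<Rightarrow> 'k) \<Rightarrow> _)"
    unfolding bounded_operator_def
  proof (intro conjI ballI allI exI)
    show "of_c0 u \<in> psi_C0 \<A>" if "u \<in> c0_space" for u :: "nat \<Rightarrow> 'k"
      using that by (rule of_c0_in)
    show "of_c0 (\<lambda>x. u x + v x) = (\<lambda>y. of_c0 u y + of_c0 v y)" for u v :: "nat \<Rightarrow> 'k"
      by (auto simp: of_c0_def fun_eq_iff split: sum.splits)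
    show "of_c0 (\<lambda>x. c * u x) = (\<lambda>y. c * of_c0 u y)" for c and u :: "nat \<Rightarrow> 'k"
      by (auto simp: of_c0_def fun_eq_iff distrib_left split: sum.splits)
    show "sup_norm (of_c0 u) \<le> 2 * sup_norm u" if "u \<in> c0_space" for u :: "nat \<Rightarrow> 'k"
      by (intro sup_norm_le norm_of_c0_le c0_norm_le that)
  qed
  show "S f = of_c0 (to_c0 (S f))" if "f \<in> psi_C0 \<A>" for f
    using of_c0_to_c0[of "S f"] S0[OF that] by simp
qed

end

text \<open>The map \<open>code\<close> witnesses that there are at most continuum many scalars, hence matrices.\<close>

theorem ex_few_operators:
  fixes code :: "'k::{real_normed_field, banach} \<Rightarrow> nat \<Rightarrow> bool"
  assumes "inj code"
  shows "\<exists>\<A> :: nat set set. uncountable \<A> \<and> (\<forall>A\<in>\<A>. infinite A) \<and> almost_disjoint \<A> \<and>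
      (\<forall>T :: (nat + nat set \<Rightarrow> 'k) \<Rightarrow> (nat + nat set \<Rightarrow> 'k).
         bounded_operator (psi_C0 \<A>) (psi_C0 \<A>) T \<longrightarrow>
         (\<exists>(c :: 'k) S. bounded_operator (psi_C0 \<A>) (psi_C0 \<A>) S \<and> factors_through_c0 (psi_C0 \<A>) S \<and>
            (\<forall>f \<in> psi_C0 \<A>. T f = (\<lambda>x. c * f x + S f x))))"
proof -
  obtain \<A> where A: "uncountable \<A>" "\<And>A. A \<in> \<A> \<Longrightarrow> infinite A" "almost_disjoint \<A>"
    and rigid: "matrix_rigid TYPE('k) \<A>"
    using ex_matrix_rigid[OF assms] by blast
  have "\<exists>(c :: 'k) S. bounded_operator (psi_C0 \<A>) (psi_C0 \<A>) S \<and> factors_through_c0 (psi_C0 \<A>) S \<and>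
            (\<forall>f \<in> psi_C0 \<A>. T f = (\<lambda>x. c * f x + S f x))"
    if T: "bounded_operator (psi_C0 \<A>) (psi_C0 \<A>) T" for T :: "(nat + nat set \<Rightarrow> 'k) \<Rightarrow> (nat + nat set \<Rightarrow> 'k)"
  proof -
    obtain l \<C> where C: "countable \<C>" "\<And>f B. f \<in> psi_C0 \<A> \<Longrightarrow> B \<in> \<A> - \<C> \<Longrightarrow> T f (Inr B) = l * f (Inr B)"
      using operator_almost_scalar[OF A(3,2) T rigid] by blast
    obtain K where K: "\<And>f x. f \<in> psi_C0 \<A> \<Longrightarrow> norm (T f x) \<le> K * sup_norm f"
      using psi_C0_bound_nonneg[OF T] by metis
    define S where "S f = (\<lambda>x. T f x + (- l) * f x)" for f
    have S: "bounded_operator (psi_C0 \<A>) (psi_C0 \<A>) S"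
      unfolding bounded_operator_def
    proof (intro conjI ballI allI exI)
      show "S f \<in> psi_C0 \<A>" if "f \<in> psi_C0 \<A>" for f
        unfolding S_def by (rule psi_C0_add[OF bounded_operator_in[OF T that] psi_C0_scale[OF that]])
      show "S (\<lambda>x. f x + g x) = (\<lambda>y. S f y + S g y)" if "f \<in> psi_C0 \<A>" "g \<in> psi_C0 \<A>" for f g
        unfolding S_def bounded_operator_add[OF T that] by (simp add: algebra_simps)
      show "S (\<lambda>x. c * f x) = (\<lambda>y. c * S f y)" if "f \<in> psi_C0 \<A>" for c f
        unfolding S_def bounded_operator_scale[OF T that] by (simp add: algebra_simps)
      show "sup_norm (S f) \<le> (K + norm l) * sup_norm f" if f: "f \<in> psi_C0 \<A>" for f
      proof (rule sup_norm_le)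
        fix x
        have "norm (S f x) \<le> norm (T f x) + norm ((- l) * f x)"
          unfolding S_def by (rule norm_triangle_ineq)
        also have "\<dots> \<le> K * sup_norm f + norm l * sup_norm f"
          using K[OF f] psi_C0_norm_le[OF f] by (intro add_mono) (simp_all add: norm_mult mult_left_mono)
        finally show "norm (S f x) \<le> (K + norm l) * sup_norm f" by (simp add: distrib_right)
      qed
    qed
    have "factors_through_c0 (psi_C0 \<A>) S"
    proof (rule factors_through_c0_if_supported[OF A(3), of "\<A> \<inter> \<C>"])
      show "S f (Inr B) = 0" if "f \<in> psi_C0 \<A>" "B \<in> \<A> - \<A> \<inter> \<C>" for f B
        using C(2)[OF that(1), of B] that(2) by (simp add: S_def)
    qed (use S C(1) in auto)
    moreover have "\<forall>f \<in> psi_C0 \<A>. T f = (\<lambda>x. l * f x + S f x)" by (simp add: S_def)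
    ultimately show ?thesis using S by blast
  qed
  with A show ?thesis
    by (intro exI[of _ \<A>] conjI ballI allI impI) assumption+
qed

section \<open>Coding real and complex scalars by bit sequences\<close>

lemma ex_code_real: "\<exists>code :: real \<Rightarrow> nat \<Rightarrow> bool. inj code"
proof
  \<comment> \<open>A real number is coded by its lower Dedekind cut in the enumerated
    rationals.\<close>
  show "inj (\<lambda>x n. real_of_rat (from_nat n) < x)"
  proof (rule injI, rule ccontr)
    fix x y :: real
    assume eq: "(\<lambda>n. real_of_rat (from_nat n) < x) = (\<lambda>n. real_of_rat (from_nat n) < y)" and "x \<noteq> y"
    then have iff: "of_rat q < x \<longleftrightarrow> of_rat q < y" for q
      using fun_cong[OF eq, of "to_nat q"] by simp
    consider "x < y" | "y < x" using \<open>x \<noteq> y\<close> by linarith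
    then show False
    proof cases
      case 1
      then obtain q where "x < of_rat q" "of_rat q < y" using of_rat_dense by blast
      then show False using iff[of q] by simp
    next
      case 2
      then obtain q where "y < of_rat q" "of_rat q < x" using of_rat_dense by blast
      then show False using iff[of q] by simp
    qed
  qed
qed

lemma ex_code_complex: "\<exists>code :: complex \<Rightarrow> nat \<Rightarrow> bool. inj code"
proof -
  obtain code :: "real \<Rightarrow> nat \<Rightarrow> bool" where code: "inj code" using ex_code_real by blast
  have "inj (\<lambda>z n. if even n then code (Re z) (n div 2) else code (Im z) (n div 2))"
  proof (rule injI)
    fix w z
    assume eq: "(\<lambda>n. if even n then code (Re w) (n div 2) else code (Im w) (n div 2)) =
      (\<lambda>n. if even n then code (Re z) (n div 2) else code (Im z) (n div 2))"
    have "code (Re w) n = code (Re z) n" "code (Im w) n = code (Im z) n" for n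
      using fun_cong[OF eq, of "2 * n"] fun_cong[OF eq, of "Suc (2 * n)"] by simp_all
    then have "code (Re w) = code (Re z)" "code (Im w) = code (Im z)" by blast+
    then show "w = z" using code by (simp add: inj_eq complex_eq_iff)
  qed
  then show ?thesis by blast
qed

theorem theorem2:
  "(\<exists>\<A> :: nat set set. uncountable \<A> \<and> (\<forall>A\<in>\<A>. infinite A) \<and> almost_disjoint \<A> \<and>
      (\<forall>T :: (nat + nat set \<Rightarrow> real) \<Rightarrow> (nat + nat set \<Rightarrow> real).
         bounded_operator (C0_space (psi_space \<A>)) (C0_space (psi_space \<A>)) T \<longrightarrow>
         (\<exists>(c :: real) S.
            bounded_operator (C0_space (psi_space \<A>)) (C0_space (psi_space \<A>)) S \<and>
            factors_through_c0 (C0_space (psi_space \<A>)) S \<and>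
            (\<forall>f \<in> C0_space (psi_space \<A>). T f = (\<lambda>x. c * f x + S f x)))))
   \<and>
   (\<exists>\<A> :: nat set set. uncountable \<A> \<and> (\<forall>A\<in>\<A>. infinite A) \<and> almost_disjoint \<A> \<and>
      (\<forall>T :: (nat + nat set \<Rightarrow> complex) \<Rightarrow> (nat + nat set \<Rightarrow> complex).
         bounded_operator (C0_space (psi_space \<A>)) (C0_space (psi_space \<A>)) T \<longrightarrow>
         (\<exists>(c :: complex) S.
            bounded_operator (C0_space (psi_space \<A>)) (C0_space (psi_space \<A>)) S \<and>
            factors_through_c0 (C0_space (psi_space \<A>)) S \<and>
            (\<forall>f \<in> C0_space (psi_space \<A>). T f = (\<lambda>x. c * f x + S f x)))))"
proof (rule conjI)
  obtain code :: "real \<Rightarrow> nat \<Rightarrow> bool" where "inj code" using ex_code_real by blast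
  then show "\<exists>\<A> :: nat set set. uncountable \<A> \<and> (\<forall>A\<in>\<A>. infinite A) \<and> almost_disjoint \<A> \<and>
      (\<forall>T :: (nat + nat set \<Rightarrow> real) \<Rightarrow> (nat + nat set \<Rightarrow> real).
         bounded_operator (C0_space (psi_space \<A>)) (C0_space (psi_space \<A>)) T \<longrightarrow>
         (\<exists>(c :: real) S.
            bounded_operator (C0_space (psi_space \<A>)) (C0_space (psi_space \<A>)) S \<and>
            factors_through_c0 (C0_space (psi_space \<A>)) S \<and>
            (\<forall>f \<in> C0_space (psi_space \<A>). T f = (\<lambda>x. c * f x + S f x))))"
    by (rule ex_few_operators)
next
  obtain code :: "complex \<Rightarrow> nat \<Rightarrow> bool" where "inj code" using ex_code_complex by blast
  then show "\<exists>\<A> :: nat set set. uncountable \<A> \<and> (\<forall>A\<in>\<A>. infinite A) \<and> almost_disjoint \<A> \<and>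
      (\<forall>T :: (nat + nat set \<Rightarrow> complex) \<Rightarrow> (nat + nat set \<Rightarrow> complex).
         bounded_operator (C0_space (psi_space \<A>)) (C0_space (psi_space \<A>)) T \<longrightarrow>
         (\<exists>(c :: complex) S.
            bounded_operator (C0_space (psi_space \<A>)) (C0_space (psi_space \<A>)) S \<and>
            factors_through_c0 (C0_space (psi_space \<A>)) S \<and>
            (\<forall>f \<in> C0_space (psi_space \<A>). T f = (\<lambda>x. c * f x + S f x))))"
    by (rule ex_few_operators)
qed

end
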